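(* Let $\mathcal B$ be the algebra of clopen subsets of $T=\prod_{n\in\mathbb N}2^n$. There are exhaustive submeasures on $\mathcal B$ of arbitrarily high countable exhaustivity rank; that is, for every countable ordinal $\alpha$ there is an exhaustive submeasure $\nu:\mathcal B\to[0,+\infty]$ whose exhaustivity rank ${\rm rk}(\nu)$ is a countable ordinal with ${\rm rk}(\nu)\ge\alpha$.
   Context: $T=\prod_{n\in\mathbb N}2^n$ is the set of all functions $x$ on $\mathbb N=\{0,1,2,\dots\}$ with $x(n)\in\{0,\dots,2^n-1\}$ for all $n$, with the product of the discrete topologies. $\mathcal B$ is the Boolean algebra of clopen subsets of $T$ (equivalently, of subsets of $T$ depending on finitely many coordinates). A submeasure on a Boolean algebra $\mathcal B$ is a function $\nu:\mathcal B\to[0,+\infty]$ with $\nu(\mathbf 0)=0$, $\nu(x)\le\nu(y)$ whenever $x\le y$, and $\nu(x\vee y)\le\nu(x)+\nu(y)$ for all $x,y$. It is exhaustive if $\lim_n\nu(a_n)=0$ for every sequence $(a_n)_n$ of pairwise disjoint elements of $\mathcal B$. Exhaustivity rank: let $\nu$ be an exhaustive submeasure on $\mathcal B$. For $\epsilon>0$ let $\mathcal D_\epsilon(\nu)$ be the set of all finite pairwise disjoint subsets $F$ of $\mathcal B$ with $\nu(a)\ge\epsilon$ for all $a\in F$. Since $\nu$ is exhaustive, $(\mathcal D_\epsilon(\nu),\supset)$ is well-founded, and one defines ${\rm rk}_\epsilon(\nu,F)=\sup\{{\rm rk}_\epsilon(\nu,G)+1: G\in\mathcal D_\epsilon(\nu),\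 G\supsetneq F\}$, ${\rm rk}_\epsilon(\nu)={\rm rk}_\epsilon(\nu,\emptyset)$, and ${\rm rk}(\nu)=\sup\{{\rm rk}_\epsilon(\nu):\epsilon>0\}$. *)

theory Defs
  imports "HOL-Analysis.Analysis"
begin

section \<open>Ordinals\<close>

text \<open>
  Ordinals are isomorphism classes of well-orders whose field is a set of elements of type
  \<open>nat set\<close>. These are exactly the ordinals of cardinality at most the continuum. In particular
  all countable ordinals and the first uncountable ordinal occur, so countability of an ordinal
  is a genuine condition. Every family of at most continuum many ordinals is bounded
  (\<open>bdd_above_ordinal\<close> below). As the algebra of clopen sets considered below is countable, all
  the suprema that occur in its exhaustivity ranks exist.
\<close>

quotient_type ordinal = "nat set rel" / partial: "\<lambda>r s. (r, s) \<in> ordIso"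
proof (rule part_equivpI)
  show "\<exists>r :: nat set rel. (r, r) \<in> ordIso"
    by (meson card_of_Well_order ordIso_reflexive)
  show "symp (\<lambda>r s :: nat set rel. (r, s) \<in> ordIso)"
    by (auto intro!: sympI ordIso_symmetric)
  show "transp (\<lambda>r s :: nat set rel. (r, s) \<in> ordIso)"
    by (auto intro!: transpI elim: ordIso_transitive)
qed

lemma ordinal_cases:
  obtains r where "Well_order r" "a = abs_ordinal r"
proof -
  have "(rep_ordinal a, rep_ordinal a) \<in> ordIso"
    using Quotient3_ordinal Quotient3_rep_reflp by fastforce
  hence "Well_order (rep_ordinal a)"
    by (auto simp: ordIso_def)
  moreover have "a = abs_ordinal (rep_ordinal a)"
    using Quotient3_abs_rep[OF Quotient3_ordinal] by simp
  ultimately show thesis using that by blast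
qed

instantiation ordinal :: wellorder
begin

lift_definition less_eq_ordinal :: "ordinal \<Rightarrow> ordinal \<Rightarrow> bool" is "\<lambda>r s. (r, s) \<in> ordLeq"
  by (meson ordIso_ordLeq_trans ordLeq_ordIso_trans ordIso_symmetric)

lift_definition less_ordinal :: "ordinal \<Rightarrow> ordinal \<Rightarrow> bool" is "\<lambda>r s. (r, s) \<in> ordLess"
  by (meson ordIso_ordLess_trans ordLess_ordIso_trans ordIso_symmetric)

lemma abs_ordinal_simps:
  assumes "Well_order r" "Well_order s"
  shows "abs_ordinal r \<le> abs_ordinal s \<longleftrightarrow> (r, s) \<in> ordLeq"
    and "abs_ordinal r < abs_ordinal s \<longleftrightarrow> (r, s) \<in> ordLess"
    and "abs_ordinal r = abs_ordinal s \<longleftrightarrow> (r, s) \<in> ordIso"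
proof -
  have *: "(r, r) \<in> ordIso" "(s, s) \<in> ordIso"
    using assms by (auto intro: ordIso_reflexive)
  show "abs_ordinal r \<le> abs_ordinal s \<longleftrightarrow> (r, s) \<in> ordLeq"
    using * by (simp add: less_eq_ordinal.abs_eq)
  show "abs_ordinal r < abs_ordinal s \<longleftrightarrow> (r, s) \<in> ordLess"
    using * by (simp add: less_ordinal.abs_eq)
  show "abs_ordinal r = abs_ordinal s \<longleftrightarrow> (r, s) \<in> ordIso"
    using * Quotient3_rel[OF Quotient3_ordinal, of r s] by auto
qed

instance
proof
  fix a b c :: ordinal
  obtain r where r: "Well_order r" "a = abs_ordinal r" by (rule ordinal_cases)
  obtain s where s: "Well_order s" "b = abs_ordinal s" by (rule ordinal_cases)
  obtain t where t: "Well_order t" "c = abs_ordinal t" by (rule ordinal_cases)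
  note simps = r(2) s(2) t(2) abs_ordinal_simps[OF r(1) s(1)] abs_ordinal_simps[OF s(1) r(1)]
    abs_ordinal_simps[OF s(1) t(1)] abs_ordinal_simps[OF r(1) t(1)] abs_ordinal_simps[OF r(1) r(1)]
  show "a < b \<longleftrightarrow> a \<le> b \<and> \<not> b \<le> a"
  proof -
    have "(r, s) \<in> ordLess \<Longrightarrow> (r, s) \<in> ordLeq" by (rule ordLess_imp_ordLeq)
    moreover have "(s, r) \<notin> ordLeq \<longleftrightarrow> (r, s) \<in> ordLess"
      by (rule not_ordLeq_iff_ordLess[OF r(1) s(1)])
    ultimately show ?thesis unfolding simps by argo
  qed
  show "a \<le> a"
    unfolding simps using r(1) by (rule ordLeq_reflexive)
  show "a \<le> c" if "a \<le> b" "b \<le> c"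
    using that unfolding simps by (rule ordLeq_transitive)
  show "a = b" if "a \<le> b" "b \<le> a"
    using that unfolding simps by (intro iffD2[OF ordIso_iff_ordLeq] conjI)
  show "a \<le> b \<or> b \<le> a"
    unfolding simps using ordLeq_total[OF r(1) s(1)] .
next
  fix P :: "ordinal \<Rightarrow> bool" and a
  assume step: "\<And>x. (\<And>y. y < x \<Longrightarrow> P y) \<Longrightarrow> P x"
  have *: "Well_order r \<Longrightarrow> P (abs_ordinal r)" for r
  proof (induction r rule: wf_induct_rule[OF wf_ordLess])
    case (1 r)
    show ?case
    proof (rule step)
      fix y assume y: "y < abs_ordinal r"
      obtain s where s: "Well_order s" "y = abs_ordinal s" by (rule ordinal_cases)
      from y have "(s, r) \<in> ordLess" unfolding s(2) abs_ordinal_simps(2)[OF s(1) 1(2)] .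
      from 1(1)[OF this s(1)] show "P y" unfolding s(2) .
    qed
  qed
  obtain r where r: "Well_order r" "a = abs_ordinal r" by (rule ordinal_cases)
  show "P a" unfolding r(2) by (rule *[OF r(1)])
qed

end

lemma card_lessThan_ordinal: "(card_of {..<a::ordinal}, card_of (UNIV :: nat set set)) \<in> ordLeq"
proof -
  obtain r where r: "Well_order r" "a = abs_ordinal r" by (rule ordinal_cases)
  have "\<exists>x. b = abs_ordinal (Restr r (underS r x))" if "b < a" for b
  proof -
    obtain s where s: "Well_order s" "b = abs_ordinal s" by (rule ordinal_cases)
    with r that have "(s, r) \<in> ordLess" by (simp add: abs_ordinal_simps)
    then obtain x where "(s, Restr r (underS r x)) \<in> ordIso"
      using ordLess_iff_ordIso_Restr r s by blast
    moreover have "Well_order (Restr r (underS r x))" using r by (simp add: Well_order_Restr)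
    ultimately show ?thesis using s abs_ordinal_simps(3) by blast
  qed
  then have "{..<a} \<subseteq> (\<lambda>x. abs_ordinal (Restr r (underS r x))) ` UNIV" by blast
  then show ?thesis
    by (meson card_of_image card_of_mono1 ordLeq_transitive)
qed

lemma not_card_ordinal_le: "(card_of (UNIV :: ordinal set), card_of (UNIV :: nat set set)) \<notin> ordLeq"
proof
  assume "(card_of (UNIV :: ordinal set), card_of (UNIV :: nat set set)) \<in> ordLeq"
  then obtain f :: "ordinal \<Rightarrow> nat set" where f: "inj f"
    using card_of_ordLeq[of "UNIV :: ordinal set" "UNIV :: nat set set"] by blast
  define L where "L = {(x, y :: ordinal). x \<le> y}"
  have FL: "Field L = UNIV" by (auto simp: L_def Field_def)
  have "Well_order L"
  proof -
    have "L - Id = {(x, y). x < y}" by (auto simp: L_def)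
    then have "wf (L - Id)" using wf by simp
    moreover have "Linear_order L"
      by (auto simp: FL linear_order_on_def partial_order_on_def preorder_on_def
          refl_on_def trans_def antisym_def total_on_def) (auto simp: L_def)
    ultimately show ?thesis by (simp add: well_order_on_def)
  qed
  then have W: "Well_order (dir_image L f)"
    using f FL by (intro Well_order_dir_image) auto
  define W where "W = dir_image L f"
  have W: "Well_order W" using W by (simp add: W_def)
  interpret W: wo_rel W by (simp add: wo_rel_def W)
  define g where "g b = abs_ordinal (Restr W (underS W (f b)))" for b
  have iff: "(f b, f c) \<in> W \<longleftrightarrow> b \<le> c" for b c
    unfolding W_def dir_image_def L_def using inj_eq[OF f] by auto
  have ws: "Well_order (Restr W (underS W x))" for x by (simp add: W Well_order_Restr)
  have "g b < g c" if "b < c" for b c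
  proof -
    have "underS W (f b) \<subset> underS W (f c)"
    proof
      show "underS W (f b) \<subseteq> underS W (f c)"
        using that W.TRANS W.ANTISYM iff[of b c] iff[of c b]
        unfolding underS_def by (auto dest: transD antisymD)
      have "f b \<in> underS W (f c)" "f b \<notin> underS W (f b)"
        using that iff[of b c] f by (auto simp: underS_def inj_def)
      then show "underS W (f b) \<noteq> underS W (f c)" by blast
    qed
    then show ?thesis
      unfolding g_def
      using ofilter_subset_ordLess[OF W W.underS_ofilter W.underS_ofilter] abs_ordinal_simps(2)[OF ws ws]
      by blast
  qed
  then have le: "b \<le> g b" for b
    by (induction b rule: less_induct) (metis leI order.strict_trans2 order_less_irrefl)
  have "g b < abs_ordinal W" for b
  proof -
    have "Field W \<noteq> {}" using iff[of b b] by (auto simp: Field_def)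
    then show ?thesis unfolding g_def using underS_Restr_ordLess[OF W] abs_ordinal_simps(2)[OF ws W] by blast
  qed
  with le[of "abs_ordinal W"] show False by (metis leD)
qed

lemma bdd_above_ordinal:
  fixes A :: "ordinal set"
  assumes "A \<lesssim> (UNIV :: nat set set)"
  shows "\<exists>b. \<forall>a\<in>A. a < b"
proof (rule ccontr)
  assume *: "\<not> ?thesis"
  have "UNIV \<subseteq> (\<Union>a\<in>A. insert a {..<a})"
    using * by (auto simp: not_less) (metis less_le)
  moreover have "(card_of (\<Union>a\<in>A. insert a {..<a}), card_of (UNIV :: nat set set)) \<in> ordLeq"
  proof (rule card_of_UNION_ordLeq_infinite)
    show inf: "infinite (UNIV :: nat set set)" by (simp add: Finite_Set.finite_set)
    show "\<forall>a\<in>A. (card_of (insert a {..<a}), card_of (UNIV :: nat set set)) \<in> ordLeq"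
    proof
      fix a :: ordinal
      have "(card_of ({a} \<union> {..<a}), card_of (UNIV :: nat set set)) \<in> ordLeq"
        using inf card_lessThan_ordinal card_of_singl_ordLeq[of "UNIV :: nat set set" a]
        by (intro card_of_Un_ordLeq_infinite_Field card_of_Card_order) (auto simp: Field_card_of)
      then show "(card_of (insert a {..<a}), card_of (UNIV :: nat set set)) \<in> ordLeq" by simp
    qed
  qed (use assms in \<open>simp add: lepoll_def flip: card_of_ordLeq\<close>)
  ultimately have "(card_of (UNIV :: ordinal set), card_of (UNIV :: nat set set)) \<in> ordLeq"
    by (meson card_of_mono1 ordLeq_transitive)
  then show False by (simp add: not_card_ordinal_le)
qed

instantiation ordinal :: "{order_bot, no_top, conditionally_complete_linorder}"
begin

lift_definition bot_ordinal :: ordinal is "{}"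
  by (rule ordIso_reflexive) simp

definition sup_ordinal :: "ordinal \<Rightarrow> ordinal \<Rightarrow> ordinal" where
  "sup_ordinal = max"

definition inf_ordinal :: "ordinal \<Rightarrow> ordinal \<Rightarrow> ordinal" where
  "inf_ordinal = min"

definition Sup_ordinal :: "ordinal set \<Rightarrow> ordinal" where
  "Sup_ordinal A = (LEAST u. \<forall>a\<in>A. a \<le> u)"

definition Inf_ordinal :: "ordinal set \<Rightarrow> ordinal" where
  "Inf_ordinal A = (LEAST a. a \<in> A)"

instance
proof
  fix a :: ordinal
  obtain r where r: "Well_order r" "a = abs_ordinal r" by (rule ordinal_cases)
  have "Well_order {}" by simp
  moreover from this r have "({}, r) \<in> ordLeq"
    unfolding ordLeq_def embed_def by auto
  ultimately show "bot \<le> a"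
    using r unfolding bot_ordinal_def by (simp add: abs_ordinal_simps)
  have "{a} \<lesssim> (UNIV :: nat set set)" by (auto simp: lepoll_def)
  then show "\<exists>b. a < b" using bdd_above_ordinal[of "{a}"] by auto
next
  fix x :: ordinal and X :: "ordinal set"
  show "Inf X \<le> x" if "x \<in> X" "bdd_below X"
    using that by (simp add: Inf_ordinal_def Least_le)
  show "x \<le> Inf X" if "X \<noteq> {}" "\<And>y. y \<in> X \<Longrightarrow> x \<le> y"
    using that unfolding Inf_ordinal_def ex_in_conv[symmetric] by (rule LeastI2_ex)
  show "x \<le> Sup X" if "x \<in> X" "bdd_above X"
    using that LeastI_ex[of "\<lambda>u. \<forall>a\<in>X. a \<le> u"] unfolding Sup_ordinal_def bdd_above_def by blast
  show "Sup X \<le> x" if "X \<noteq> {}" "\<And>y. y \<in> X \<Longrightarrow> y \<le> x"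
    using that unfolding Sup_ordinal_def by (simp add: Least_le)
qed (auto simp: sup_ordinal_def inf_ordinal_def)

end

lemma Sup_ordinal_empty [simp]: "Sup {} = (bot :: ordinal)"
  unfolding Sup_ordinal_def by (simp add: Least_equality)

definition succ_ordinal :: "ordinal \<Rightarrow> ordinal" where
  "succ_ordinal a = (LEAST b. a < b)"

lift_definition countable_ordinal :: "ordinal \<Rightarrow> bool" is "\<lambda>r. countable (Field r)"
proof -
  fix r s :: "nat set rel"
  assume "(r, s) \<in> ordIso"
  then obtain f where "iso r s f" by (auto simp: ordIso_def)
  then have "bij_betw f (Field r) (Field s)" by (simp add: iso_def)
  then show "countable (Field r) = countable (Field s)" by simp
qed


section \<open>Exhaustive submeasures and their rank\<close>

text \<open>
  Boolean algebras are represented as algebras \<open>B\<close> of subsets of a space. Submeasures are total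
  functions on sets of which only the values on \<open>B\<close> are relevant.
\<close>

definition submeasure :: "'a set set \<Rightarrow> ('a set \<Rightarrow> ennreal) \<Rightarrow> bool" where
  "submeasure B \<nu> \<longleftrightarrow>
     \<nu> {} = 0 \<and>
     (\<forall>x\<in>B. \<forall>y\<in>B. x \<subseteq> y \<longrightarrow> \<nu> x \<le> \<nu> y) \<and>
     (\<forall>x\<in>B. \<forall>y\<in>B. \<nu> (x \<union> y) \<le> \<nu> x + \<nu> y)"

definition exhaustive :: "'a set set \<Rightarrow> ('a set \<Rightarrow> ennreal) \<Rightarrow> bool" where
  "exhaustive B \<nu> \<longleftrightarrow>
     (\<forall>a :: nat \<Rightarrow> 'a set. range a \<subseteq> B \<and> disjoint_family a \<longrightarrow> (\<lambda>n. \<nu> (a n)) \<longlonglongrightarrow> 0)"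

text \<open>
  The rank is defined by recursion along proper extension of disjoint families. The recursion
  is well-founded if \<open>\<nu>\<close> is exhaustive and \<open>\<epsilon> > 0\<close>; the recursion equation is
  \<open>rank_at_eq\<close> below. For other arguments, the value of \<open>rank_at\<close> has no meaning.
\<close>

definition disjoint_families :: "'a set set \<Rightarrow> ('a set \<Rightarrow> ennreal) \<Rightarrow> real \<Rightarrow> 'a set set set" where
  "disjoint_families B \<nu> \<epsilon> =
     {F. finite F \<and> F \<subseteq> B \<and> disjoint F \<and> (\<forall>a\<in>F. ennreal \<epsilon> \<le> \<nu> a)}"

definition extension_rel :: "'a set set \<Rightarrow> ('a set \<Rightarrow> ennreal) \<Rightarrow> real \<Rightarrow> 'a set set rel" where
  "extension_rel B \<nu> \<epsilon> = {(G, F). G \<in> disjoint_families B \<nu> \<epsilon> \<and> F \<subset> G}"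

definition rank_at :: "'a set set \<Rightarrow> ('a set \<Rightarrow> ennreal) \<Rightarrow> real \<Rightarrow> 'a set set \<Rightarrow> ordinal" where
  "rank_at B \<nu> \<epsilon> = wfrec (extension_rel B \<nu> \<epsilon>)
     (\<lambda>rk F. SUP G \<in> {G \<in> disjoint_families B \<nu> \<epsilon>. F \<subset> G}. succ_ordinal (rk G))"

definition exhaustivity_rank :: "'a set set \<Rightarrow> ('a set \<Rightarrow> ennreal) \<Rightarrow> ordinal" where
  "exhaustivity_rank B \<nu> = (SUP \<epsilon> \<in> {0<..}. rank_at B \<nu> \<epsilon> {})"

lemma wf_extension_rel:
  assumes "exhaustive B \<nu>" "\<epsilon> > 0"
  shows "wf (extension_rel B \<nu> \<epsilon>)"
proof (rule ccontr)
  assume "\<not> ?thesis"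
  then obtain F where F: "\<And>i. (F (Suc i), F i) \<in> extension_rel B \<nu> \<epsilon>"
    unfolding wf_iff_no_infinite_down_chain by blast
  then have D: "F (Suc i) \<in> disjoint_families B \<nu> \<epsilon>" and ss: "F i \<subset> F (Suc i)" for i
    by (auto simp: extension_rel_def)
  have "\<forall>i. \<exists>x. x \<in> F (Suc i) - F i" using ss by blast
  then obtain a where a: "\<And>i. a i \<in> F (Suc i) - F i" by metis
  have mono: "F i \<subseteq> F j" if "i \<le> j" for i j
    using lift_Suc_mono_le[of F i j] ss that by blast
  have disj: "a i \<inter> a j = {}" if "i < j" for i j
  proof -
    have "a i \<in> F (Suc j)" "a i \<in> F j" using a[of i] mono[of "Suc i" j] ss[of j] that by auto
    moreover have "a j \<in> F (Suc j)" "a j \<notin> F j" using a[of j] by auto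
    moreover have "disjoint (F (Suc j))" using D by (simp add: disjoint_families_def)
    ultimately show ?thesis by (metis disjointD)
  qed
  then have "disjoint_family a"
    unfolding disjoint_family_on_def by (metis Int_commute linorder_neqE_nat)
  moreover have "range a \<subseteq> B" using a D by (fastforce simp: disjoint_families_def)
  ultimately have "(\<lambda>n. \<nu> (a n)) \<longlonglongrightarrow> 0" using assms by (simp add: exhaustive_def)
  moreover have "ennreal \<epsilon> \<le> \<nu> (a n)" for n using a[of n] D[of n] by (auto simp: disjoint_families_def)
  ultimately have "ennreal \<epsilon> \<le> 0" by (intro LIMSEQ_le_const) auto
  with assms show False by simp
qed

lemma rank_at_eq:
  assumes "exhaustive B \<nu>" "\<epsilon> > 0"
  shows "rank_at B \<nu> \<epsilon> F =
    (SUP G \<in> {G \<in> disjoint_families B \<nu> \<epsilon>. F \<subset> G}. succ_ordinal (rank_at B \<nu> \<epsilon> G))"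
proof -
  have "rank_at B \<nu> \<epsilon> F = (SUP G \<in> {G \<in> disjoint_families B \<nu> \<epsilon>. F \<subset> G}.
      succ_ordinal (cut (rank_at B \<nu> \<epsilon>) (extension_rel B \<nu> \<epsilon>) F G))"
    unfolding rank_at_def by (subst wfrec[OF wf_extension_rel[OF assms]]) simp
  also have "\<dots> = (SUP G \<in> {G \<in> disjoint_families B \<nu> \<epsilon>. F \<subset> G}. succ_ordinal (rank_at B \<nu> \<epsilon> G))"
    by (intro arg_cong[where f = Sup] image_cong) (auto simp: cut_apply extension_rel_def)
  finally show ?thesis .
qed


section \<open>The space\<close>

definition T_top :: "(nat \<Rightarrow> nat) topology" where
  "T_top = product_topology (\<lambda>n. discrete_topology {..<2 ^ n}) UNIV"

definition clopens :: "(nat \<Rightarrow> nat) set set" where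
  "clopens = {A. openin T_top A \<and> closedin T_top A}"

end

theory Submission
  imports Defs
begin

text \<open>
  The submeasure is a variant of Talagrand's exhaustive pathological submeasure. A \<^emph>\<open>piece\<close> of class
  \<open>l\<close> is a set \<open>E\<close> with a finite set \<open>I\<close> of levels such that for all \<open>m < n\<close> in \<open>I\<close>, below every atom of
  level \<open>m\<close>, the atoms of level \<open>n\<close> disjoint from \<open>E\<close> form a set that cannot be covered by pieces of
  higher classes of total weight less than 1. The weight of a piece decreases to \<open>2\<^sup>-\<^sup>l\<close> when a norm of
  \<open>I\<close> grows, and \<open>nu A\<close> is the least total weight of a cover of \<open>A\<close> by pieces. As only the pieces with
  levels up to \<open>n\<close> matter for the condition at \<open>n\<close>, the definition is a recursion and needs no limit
  along an ultrafilter.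

  The whole space has no cover of small weight: the few pieces of class \<open>k\<close> in a cover have many
  levels, and so can be avoided on pairwise disjoint intervals of levels that are almost irrelevant
  to the other pieces. If the members of a disjoint sequence are cut down by a set of small
  submeasure, they are eventually pieces of class \<open>k\<close> of the minimal weight \<open>2\<^sup>-\<^sup>k\<close>. Hence \<open>nu\<close> is
  exhaustive.

  For the rank, let \<open>F\<close> be the family of finite sets of levels on which a fixed map \<open>f\<close> into a
  countable well-order is decreasing. The norm is chosen such that cutting a set of levels at the
  points of a member of \<open>F\<close> leaves an interval of almost the same norm. So fixing the coordinates in
  a member of \<open>F\<close> leaves a set with \<open>nu \<ge> 1\<close>, and the disjoint families of such cylinders have at
  least the rank of the well-order.
\<close>

section \<open>Pieces and their weights\<close>

definition points :: "(nat \<Rightarrow> nat) set" where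
  "points = {x. \<forall>n. x n < 2 ^ n}"

definition graft :: "nat \<Rightarrow> (nat \<Rightarrow> nat) \<Rightarrow> (nat \<Rightarrow> nat) \<Rightarrow> nat \<Rightarrow> nat" where
  "graft m x y = (\<lambda>i. if i < m then x i else y i)"

text \<open>The set \<open>E\<close> misses the atom of level \<open>b\<close> around
  \<open>x\<close>, where an atom of level \<open>b\<close> fixes the coordinates below
  \<open>b\<close>.\<close>

definition kills :: "nat \<Rightarrow> (nat \<Rightarrow> nat) \<Rightarrow> (nat \<Rightarrow> nat) set \<Rightarrow> bool" where
  "kills b x E \<longleftrightarrow> (\<forall>z\<in>E. \<exists>i<b. z i \<noteq> x i)"

text \<open>Relative to \<open>points\<close>, membership in \<open>A\<close> depends only on the
  coordinates below \<open>n\<close>; for \<open>ind m\<close> it depends only on those from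
  \<open>m\<close> on.\<close>

definition dep :: "nat \<Rightarrow> (nat \<Rightarrow> nat) set \<Rightarrow> bool" where
  "dep n A \<longleftrightarrow> (\<forall>y\<in>A. \<forall>z\<in>points. (\<forall>i<n. z i = y i) \<longrightarrow> z \<in> A)"

definition ind :: "nat \<Rightarrow> (nat \<Rightarrow> nat) set \<Rightarrow> bool" where
  "ind m A \<longleftrightarrow> (\<forall>y\<in>A. \<forall>z\<in>points. (\<forall>i\<ge>m. z i = y i) \<longrightarrow> z \<in> A)"

lemma zero_in_points: "(\<lambda>_. 0) \<in> points"
  by (simp add: points_def)

lemma graft_in_points: "x \<in> points \<Longrightarrow> y \<in> points \<Longrightarrow> graft m x y \<in> points"
  by (simp add: points_def graft_def)

lemma graft_less [simp]: "i < m \<Longrightarrow> graft m x y i = x i"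
  and graft_ge [simp]: "m \<le> i \<Longrightarrow> graft m x y i = y i"
  by (simp_all add: graft_def)

lemma graft_0 [simp]: "graft 0 x y = y"
  by (simp add: graft_def)

lemma kills_cong: "(\<And>i. i < b \<Longrightarrow> x i = y i) \<Longrightarrow> kills b x E = kills b y E"
  unfolding kills_def by (intro ball_cong refl ex_cong1) auto

lemma kills_mono: "kills b x E \<Longrightarrow> b \<le> c \<Longrightarrow> E' \<subseteq> E \<Longrightarrow> kills c x E'"
  unfolding kills_def by (meson less_le_trans subsetD)

lemma not_in_kills: "kills b x E \<Longrightarrow> (\<And>i. i < b \<Longrightarrow> z i = x i) \<Longrightarrow> z \<notin> E"
  unfolding kills_def by auto

text \<open>Raw triples. The condition that makes one a piece is the separate predicate
  \<open>good\<close>, because it refers recursively to pieces of higher classes.\<close>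

datatype piece = Piece (body: "(nat \<Rightarrow> nat) set") (lev: "nat set") (cls: nat)

text \<open>
  A loss of one in the norm multiplies the weight of a piece of class \<open>l\<close> by \<open>1 + slack l\<close>. Cutting
  the levels into the intervals used for class \<open>k\<close> loses at most \<open>2 ^ (k + 5)\<close>; for classes above \<open>k\<close>
  this costs a factor of at most \<open>capacity (Suc k) / capacity k\<close>. A piece of weight below 32 has norm
  above \<open>min_norm l\<close>, and norm \<open>full_norm l\<close> gives the minimal weight \<open>2\<^sup>-\<^sup>l\<close>.
\<close>

definition slack :: "nat \<Rightarrow> real" where
  "slack l = (1/4) ^ l / 16"

definition min_norm :: "nat \<Rightarrow> nat" where
  "min_norm l = 2 ^ (l + 10)"

definition full_norm :: "nat \<Rightarrow> nat" where
  "full_norm l = min_norm l + 512 * 8 ^ l"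

definition capacity :: "nat \<Rightarrow> real" where
  "capacity k = 16 * exp (- ((1/2) ^ k))"

lemma slack_pos: "0 < slack l"
  by (simp add: slack_def)

lemma slack_le_1: "slack l \<le> 1"
  using power_le_one[of "1/4::real" l] by (simp add: slack_def)

text \<open>By \<open>1 + s \<le> exp s\<close> the power is at most
  \<open>exp (n * slack l)\<close>, and \<open>2 ^ (k + 5) * slack (Suc k)\<close> equals
  \<open>(1/2) ^ Suc k\<close>.\<close>

lemma slack_power_le:
  assumes "k < l" "n \<le> 2 ^ (k + 5)"
  shows "(1 + slack l) ^ n \<le> exp ((1/2) ^ Suc k)"
proof -
  have "(1 + slack l) ^ n \<le> exp (slack l) ^ n"
    using slack_pos[of l] exp_ge_add_one_self[of "slack l"] by (intro power_mono) auto
  also have "\<dots> = exp (n * slack l)"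
    by (simp add: exp_of_nat_mult)
  also have "n * slack l \<le> 2 ^ (k + 5) * slack (Suc k)"
  proof (rule mult_mono)
    show "real n \<le> 2 ^ (k + 5)" using assms(2) by (metis of_nat_le_iff of_nat_numeral of_nat_power)
    show "slack l \<le> slack (Suc k)"
      using assms(1) unfolding slack_def by (intro divide_right_mono power_decreasing) auto
  qed (auto simp: slack_pos less_imp_le)
  also have "\<dots> = (1/2) ^ Suc k"
  proof -
    have "(2::real) ^ k * (1/4) ^ k = (1/2) ^ k" by (simp flip: power_mult_distrib)
    then show ?thesis by (simp add: slack_def power_add)
  qed
  finally show ?thesis by simp
qed

lemma capacity_Suc: "exp ((1/2) ^ Suc k) * capacity k = capacity (Suc k)"
  by (simp add: capacity_def flip: exp_add)

lemma capacity_less: "capacity k < 16"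
  by (simp add: capacity_def)

lemma exp_half_power_less_2: "exp ((1/2::real) ^ Suc k) < 2"
proof -
  have "(1/2::real) ^ Suc k \<le> 1/2" using power_le_one[of "1/2::real" k] by simp
  then have "exp ((1/2::real) ^ Suc k) \<le> exp (1/2)" by simp
  also have "\<dots> < 2"
  proof (rule ccontr)
    assume "\<not> exp (1/2::real) < 2"
    then have "2 * 2 \<le> exp (1/2::real) * exp (1/2)" by (intro mult_mono) auto
    also have "\<dots> = exp 1" by (simp flip: exp_add)
    also have "\<dots> \<le> 3" by (rule exp_le)
    finally show False by simp
  qed
  finally show ?thesis .
qed

text \<open>The capacities increase from \<open>16 / exp 1\<close>, and
  \<open>exp 1 \<le> 3\<close>.\<close>

lemma capacity_gt: "5 < capacity k"
proof -
  have "exp ((1/2::real) ^ k) \<le> exp 1" using power_le_one[of "1/2::real" k] by simp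
  also have "\<dots> \<le> 3" by (rule exp_le)
  finally have "exp ((1/2::real) ^ k) * 5 < 16" by simp
  then show ?thesis by (simp add: capacity_def exp_minus field_simps)
qed

text \<open>The norm \<open>h\<close> measures finite sets of levels. The crucial axiom is
  \<open>norm_cut\<close>: cutting at all points of a member of \<open>F\<close> simultaneously
  costs a single unit of norm, however many points there are. By \<open>norm_unbounded\<close>,
  every infinite set of levels contains a level set for a piece of minimal weight; by
  \<open>norm_le_card\<close>, pieces of weight below 32 have many levels.\<close>

locale norm_family =
  fixes h :: "nat set \<Rightarrow> nat" and F :: "nat set set"
  assumes norm_mono: "finite B \<Longrightarrow> A \<subseteq> B \<Longrightarrow> h A \<le> h B"
    and norm_le_card: "finite A \<Longrightarrow> h A \<le> card A"
    and norm_cut: "J \<in> F \<Longrightarrow> finite A \<Longrightarrow>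
          \<exists>K\<subseteq>A. (\<forall>j\<in>J. K \<subseteq> {..j} \<or> K \<subseteq> {j<..}) \<and> h A \<le> Suc (h K)"
    and norm_unbounded: "infinite M \<Longrightarrow> \<exists>A\<subseteq>M. finite A \<and> N \<le> h A"
    and singleton_family: "{n} \<in> F"
    and family_finite: "J \<in> F \<Longrightarrow> finite J"
begin

text \<open>Truncated subtraction keeps the weight at \<open>(1/2) ^ l\<close> once the norm reaches
  \<open>full_norm l\<close>.\<close>

definition weight :: "nat \<Rightarrow> nat set \<Rightarrow> real" where
  "weight l I = (1/2) ^ l * (1 + slack l) ^ (full_norm l - h I)"

definition wgt :: "piece \<Rightarrow> real" where
  "wgt t = weight (cls t) (lev t)"

definition wt :: "piece set \<Rightarrow> real" where
  "wt X = (\<Sum>t\<in>X. wgt t)"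

context
  notes conj_cong [fundef_cong] imp_cong [fundef_cong]
begin

text \<open>The family \<open>X\<close> is a would-be cover of small weight, seen from below the
  atom of level \<open>m\<close> around \<open>x\<close>. The conjunct
  \<open>\<exists>i\<in>lev t. cls t < i\<close> makes the recursion terminate: from
  \<open>t\<close> to \<open>s\<close> the maximal level does not grow and the class does, so their
  truncated difference drops from a positive value. The congruence rules above make these guards
  available in the termination proof.\<close>

function good :: "piece \<Rightarrow> bool" where
  "good t \<longleftrightarrow> finite (lev t) \<and> (\<exists>i\<in>lev t. cls t < i) \<and>
    (\<forall>n\<in>lev t. \<forall>m\<in>lev t. m < n \<longrightarrow> (\<forall>x\<in>points. \<forall>X. finite X \<and>
       (\<forall>s\<in>X. cls t < cls s \<and> lev s \<subseteq> {..n} \<and> good s) \<and> wt X < 1 \<longrightarrow>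
       (\<exists>y\<in>points. kills n (graft m x y) (body t) \<and> (\<forall>s\<in>X. y \<notin> body s))))"
  by auto
termination
proof (relation "Wellfounded.measure (\<lambda>t. Max (insert 0 (lev t)) - cls t)")
  fix t n m x X s
  assume *: "finite (lev t)" "\<exists>i\<in>lev t. cls t < i" "n \<in> lev t" "s \<in> X" "cls t < cls s" "lev s \<subseteq> {..n}"
  have "cls t < Max (insert 0 (lev t))" using * by (auto simp: Max_gr_iff)
  moreover have "Max (insert 0 (lev s)) \<le> n"
    using * finite_subset[OF *(6)] by (subst Max_le_iff) auto
  moreover have "n \<le> Max (insert 0 (lev t))" using * by (intro Max_ge) auto
  ultimately have "Max (insert 0 (lev s)) - cls s < Max (insert 0 (lev t)) - cls t" 
    using *(5) by linarith
  then show "(s, t) \<in> Wellfounded.measure (\<lambda>t. Max (insert 0 (lev t)) - cls t)" by simp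
qed auto

end

declare good.simps [simp del]

text \<open>Admissible families, which serve as covers. The lower bound on the classes matters
  because a piece of class \<open>k\<close> is tested by pieces of classes above
  \<open>k\<close>.\<close>

definition adm :: "nat \<Rightarrow> piece set \<Rightarrow> bool" where
  "adm k X \<longleftrightarrow> finite X \<and> (\<forall>t\<in>X. good t \<and> k \<le> cls t)"

text \<open>The coordinates below \<open>a\<close> are frozen to \<open>x\<close>, and the body is
  enlarged to a set decided at level \<open>b\<close>: a point \<open>y\<close> outside it is one
  for which the atom of level \<open>b\<close> around \<open>graft a x y\<close> misses
  \<open>body t\<close>.\<close>

definition rest :: "(nat \<Rightarrow> nat) \<Rightarrow> nat \<Rightarrow> nat \<Rightarrow> piece \<Rightarrow> piece" where
  "rest x a b t = Piece {y \<in> points. \<not> kills b (graft a x y) (body t)} (lev t \<inter> {a..b}) (cls t)"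

lemma rest_simps [simp]:
  "body (rest x a b t) = {y \<in> points. \<not> kills b (graft a x y) (body t)}"
  "lev (rest x a b t) = lev t \<inter> {a..b}"
  "cls (rest x a b t) = cls t"
  by (simp_all add: rest_def)

lemma good_finite: "good t \<Longrightarrow> finite (lev t)"
  by (subst (asm) good.simps) blast

lemma good_thin:
  assumes "good t" "m \<in> lev t" "n \<in> lev t" "m < n" "x \<in> points"
    and "adm (Suc (cls t)) X" "\<And>s. s \<in> X \<Longrightarrow> lev s \<subseteq> {..n}" "wt X < 1"
  obtains y where "y \<in> points" "kills n (graft m x y) (body t)" "\<And>s. s \<in> X \<Longrightarrow> y \<notin> body s"
proof -
  have X: "finite X \<and> (\<forall>s\<in>X. cls t < cls s \<and> lev s \<subseteq> {..n} \<and> good s) \<and> wt X < 1"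
    using assms(6-8) by (auto simp: adm_def)
  have "\<exists>y\<in>points. kills n (graft m x y) (body t) \<and> (\<forall>s\<in>X. y \<notin> body s)"
    using assms(1)[unfolded good.simps[of t]] assms(2-5) X by blast
  then show thesis using that by blast
qed

lemma goodI:
  assumes "finite (lev t)" "\<exists>i\<in>lev t. cls t < i"
    and "\<And>m n x X. \<lbrakk>m \<in> lev t; n \<in> lev t; m < n; x \<in> points; adm (Suc (cls t)) X;
           \<And>s. s \<in> X \<Longrightarrow> lev s \<subseteq> {..n}; wt X < 1\<rbrakk> \<Longrightarrow>
           \<exists>y\<in>points. kills n (graft m x y) (body t) \<and> (\<forall>s\<in>X. y \<notin> body s)"
  shows "good t"
proof (subst good.simps, intro conjI ballI allI impI)
  fix n m x X
  assume "n \<in> lev t" "m \<in> lev t" "m < n" "x \<in> points"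
    "finite X \<and> (\<forall>s\<in>X. cls t < cls s \<and> lev s \<subseteq> {..n} \<and> good s) \<and> wt X < 1"
  then show "\<exists>y\<in>points. kills n (graft m x y) (body t) \<and> (\<forall>s\<in>X. y \<notin> body s)"
    by (intro assms(3)) (auto simp: adm_def Suc_le_eq)
qed (use assms(1,2) in auto)

section \<open>Bounds for weights and norms\<close>

lemma weight_pos: "0 < weight l I"
  using slack_pos[of l] by (simp add: weight_def add_pos_pos)

lemma wgt_nonneg: "0 \<le> wgt t"
  using weight_pos[of "cls t" "lev t"] by (simp add: wgt_def)

lemma wt_nonneg: "0 \<le> wt X"
  by (simp add: wt_def sum_nonneg wgt_nonneg)

lemma wt_mono: "finite Y \<Longrightarrow> X \<subseteq> Y \<Longrightarrow> wt X \<le> wt Y"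
  unfolding wt_def by (rule sum_mono2) (auto simp: wgt_nonneg)

lemma wgt_le_wt: "finite X \<Longrightarrow> t \<in> X \<Longrightarrow> wgt t \<le> wt X"
  using wt_mono[of X "{t}"] by (simp add: wt_def)

lemma wt_empty [simp]: "wt {} = 0"
  by (simp add: wt_def)

lemma wt_Un_le: "finite X \<Longrightarrow> finite Y \<Longrightarrow> wt (X \<union> Y) \<le> wt X + wt Y"
  using sum.union_inter[of X Y wgt] wt_nonneg[of "X \<inter> Y"] by (simp add: wt_def)

lemma weight_ge: "(1/2) ^ l \<le> weight l I"
  using slack_pos[of l] one_le_power[of "1 + slack l" "full_norm l - h I"]
  by (simp add: weight_def mult_le_cancel_left1)

lemma weight_full: "full_norm l \<le> h I \<Longrightarrow> weight l I = (1/2) ^ l"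
  by (simp add: weight_def)

lemma weight_le:
  assumes "h I \<le> h I' + r"
  shows "weight l I' \<le> (1 + slack l) ^ r * weight l I"
proof -
  have "(1 + slack l) ^ (full_norm l - h I') \<le> (1 + slack l) ^ (r + (full_norm l - h I))"
    using assms slack_pos[of l] by (intro power_increasing) auto
  then show ?thesis by (simp add: weight_def power_add mult_ac)
qed

text \<open>With norm at most \<open>min_norm l\<close> the exponent in the weight is at least
  \<open>512 * 8 ^ l\<close>, and Bernoulli's inequality makes the power at least
  \<open>32 * 2 ^ l\<close>.\<close>

lemma norm_large:
  assumes "weight l I < 32"
  shows "min_norm l < h I"
proof (rule ccontr)
  assume "\<not> min_norm l < h I"
  then have *: "512 * 8 ^ l \<le> full_norm l - h I" by (simp add: full_norm_def)
  have e: "real (512 * 8 ^ l) * slack l = 32 * 2 ^ l"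
  proof -
    have "(8::real) ^ l * (1/4) ^ l = 2 ^ l" by (simp flip: power_mult_distrib)
    then show ?thesis by (simp add: slack_def)
  qed
  have "32 * 2 ^ l \<le> 1 + real (512 * 8 ^ l) * slack l" unfolding e by simp
  also have "\<dots> \<le> (1 + slack l) ^ (512 * 8 ^ l)"
    using slack_pos[of l] by (intro Bernoulli_inequality) auto
  also have "\<dots> \<le> (1 + slack l) ^ (full_norm l - h I)"
    using * slack_pos[of l] by (intro power_increasing) auto
  finally have "(1/2) ^ l * (32 * 2 ^ l) \<le> weight l I"
    unfolding weight_def by (intro mult_left_mono) auto
  moreover have "(1/2) ^ l * (32 * 2 ^ l) = (32::real)" by (simp add: power_divide)
  ultimately show False using assms by simp
qed

lemma card_large:
  assumes "weight l I < 32" "finite I"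
  shows "min_norm l < card I"
  using norm_large[OF assms(1)] norm_le_card[OF assms(2)] by simp

text \<open>Provides the termination conjunct of \<open>good\<close>: small weight forces more than
  \<open>min_norm l\<close> levels, which do not fit into \<open>{..l}\<close>.\<close>

lemma guard:
  assumes "weight l I < 32" "finite I"
  shows "\<exists>i\<in>I. l < i"
proof (rule ccontr)
  assume "\<not> ?thesis"
  then have "I \<subseteq> {..l}" by auto
  then have "card I \<le> Suc l" using card_mono[of "{..l}" I] by simp
  moreover have "Suc l < min_norm l"
    using less_exp[of "l + 10"] unfolding min_norm_def by linarith
  ultimately show False using card_large[OF assms] by simp
qed

text \<open>Below the atom of level \<open>m \<ge> a\<close> around \<open>u\<close>, use the
  condition for \<open>t\<close> below \<open>graft a x u\<close>. What kills \<open>body t\<close>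
  at level \<open>n \<le> b\<close> also kills the enlarged body, since each of its points agrees,
  after grafting, with a point of \<open>body t\<close> below \<open>b\<close>.\<close>

lemma good_rest:
  assumes t: "good t" and x: "x \<in> points" and g: "\<exists>i\<in>lev t \<inter> {a..b}. cls t < i"
  shows "good (rest x a b t)"
proof (rule goodI)
  fix m n u X
  assume m: "m \<in> lev (rest x a b t)" and n: "n \<in> lev (rest x a b t)" and mn: "m < n" and u: "u \<in> points"
    and X: "adm (Suc (cls (rest x a b t))) X" "\<And>s. s \<in> X \<Longrightarrow> lev s \<subseteq> {..n}" "wt X < 1"
  have "m \<in> lev t" "n \<in> lev t" "graft a x u \<in> points" "adm (Suc (cls t)) X"
    using m n x u X(1) by (auto intro: graft_in_points)
  from good_thin[OF t this(1,2) mn this(3,4) X(2,3)] obtain y where y: "y \<in> points"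
    "kills n (graft m (graft a x u) y) (body t)" "\<And>s. s \<in> X \<Longrightarrow> y \<notin> body s" by blast
  have "kills n (graft m u y) (body (rest x a b t))"
    unfolding kills_def
  proof
    fix z assume "z \<in> body (rest x a b t)"
    then obtain z' where z': "z' \<in> body t" "\<And>i. i < b \<Longrightarrow> z' i = graft a x z i"
      by (auto simp: kills_def)
    from y(2) z'(1) obtain i where i: "i < n" "z' i \<noteq> graft m (graft a x u) y i"
      by (auto simp: kills_def)
    have "i < b" using i(1) n by simp
    then have "graft a x z i \<noteq> graft m (graft a x u) y i" using i z'(2) by simp
    then have "z i \<noteq> graft m u y i" using m by (auto simp: graft_def split: if_splits)
    then show "\<exists>i<n. z i \<noteq> graft m u y i" using i(1) by blast
  qed
  then show "\<exists>y\<in>points. kills n (graft m u y) (body (rest x a b t)) \<and> (\<forall>s\<in>X. y \<notin> body s)"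
    using y by blast
qed (use t x g good_finite in auto)

text \<open>Losing \<open>r\<close> units of norm multiplies each weight by at most
  \<open>K\<close>. As \<open>K * wt X\<close> is below 32, so is the weight of every restricted
  piece, and \<open>guard\<close> yields the side condition of \<open>good_rest\<close>.\<close>

lemma rest_image:
  assumes X: "adm k X" and x: "x \<in> points"
    and hle: "\<And>t. t \<in> X \<Longrightarrow> h (lev t) \<le> h (lev t \<inter> {a..b}) + r"
    and K: "\<And>l. k \<le> l \<Longrightarrow> (1 + slack l) ^ r \<le> K"
    and small: "K * wt X < 32"
  shows "adm k (rest x a b ` X)" "wt (rest x a b ` X) \<le> K * wt X"
proof -
  have K0: "0 \<le> K" using K[of k] slack_pos[of k] by (meson add_nonneg_nonneg le_less order_trans zero_le_one zero_le_power)
  have fin: "finite X" using X by (simp add: adm_def)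
  have w: "wgt (rest x a b t) \<le> K * wgt t" if "t \<in> X" for t
  proof -
    have "k \<le> cls t" using X that by (simp add: adm_def)
    have "wgt (rest x a b t) \<le> (1 + slack (cls t)) ^ r * wgt t"
      using weight_le[OF hle[OF that], of "cls t"] by (simp add: wgt_def)
    also have "\<dots> \<le> K * wgt t" using K[OF \<open>k \<le> cls t\<close>] by (intro mult_right_mono wgt_nonneg)
    finally show ?thesis .
  qed
  show "adm k (rest x a b ` X)"
    unfolding adm_def
  proof (intro conjI ballI)
    fix s assume "s \<in> rest x a b ` X"
    then obtain t where t: "t \<in> X" "s = rest x a b t" by blast
    have gt: "good t" "k \<le> cls t" using X t by (auto simp: adm_def)
    have "wgt (rest x a b t) \<le> K * wt X"
      using w[OF t(1)] mult_left_mono[OF wgt_le_wt[OF fin t(1)] K0] by simp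
    then have "weight (cls t) (lev t \<inter> {a..b}) < 32" using small by (simp add: wgt_def)
    then have "\<exists>i\<in>lev t \<inter> {a..b}. cls t < i" using good_finite[OF gt(1)] by (intro guard) auto
    then show "good s" "k \<le> cls s" using good_rest[OF gt(1) x] t gt by auto
  qed (use fin in auto)
  have "wt (rest x a b ` X) \<le> (\<Sum>t\<in>X. wgt (rest x a b t))"
    unfolding wt_def by (rule sum_image_le[OF fin, of wgt, unfolded comp_def]) (auto simp: wgt_nonneg)
  also have "\<dots> \<le> (\<Sum>t\<in>X. K * wgt t)" by (intro sum_mono w)
  also have "\<dots> = K * wt X" by (simp add: wt_def sum_distrib_left)
  finally show "wt (rest x a b ` X) \<le> K * wt X" .
qed

end

section \<open>Avoiding covers of small weight\<close>

lemma enumerate_levels: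
  fixes D :: "nat set"
  assumes "finite D" "N < card D"
  obtains j :: "nat \<Rightarrow> nat" where "\<And>q. q \<le> N \<Longrightarrow> j q \<in> D" "\<And>p q. p < q \<Longrightarrow> q \<le> N \<Longrightarrow> j p < j q"
proof
  let ?j = "\<lambda>q. sorted_list_of_set D ! q"
  have len: "length (sorted_list_of_set D) = card D" using assms by simp
  show "?j q \<in> D" if "q \<le> N" for q
    using that assms len nth_mem[of q "sorted_list_of_set D"] by simp
  show "?j p < ?j q" if "p < q" "q \<le> N" for p q
    using that assms len by (intro sorted_wrt_nth_less[of "(<)"]) auto
qed

context norm_family
begin

lemma norm_cut_point:
  assumes "finite A"
  shows "h A \<le> Suc (h (A \<inter> {..n})) \<or> h A \<le> Suc (h (A \<inter> {n..}))"
proof -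
  obtain K where K: "K \<subseteq> A" "K \<subseteq> {..n} \<or> K \<subseteq> {n<..}" "h A \<le> Suc (h K)"
    using norm_cut[OF singleton_family[of n] assms] by auto
  from K(2) show ?thesis
  proof
    assume "K \<subseteq> {..n}"
    then have "h K \<le> h (A \<inter> {..n})" using K(1) assms by (intro norm_mono) auto
    then show ?thesis using K(3) by simp
  next
    assume "K \<subseteq> {n<..}"
    then have "h K \<le> h (A \<inter> {n..})" using K(1) assms by (intro norm_mono) (auto simp: less_imp_le)
    then show ?thesis using K(3) by simp
  qed
qed

text \<open>The bound \<open>p\<close> on the classes permits a downward induction on
  \<open>k\<close>; every finite family has such a bound.\<close>

definition avoidable :: "nat \<Rightarrow> nat \<Rightarrow> bool" where
  "avoidable p k \<longleftrightarrow> (\<forall>X. adm k X \<and> (\<forall>t\<in>X. cls t < p) \<and> wt X < capacity k \<longrightarrow>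
     (\<exists>z\<in>points. \<forall>t\<in>X. z \<notin> body t))"

text \<open>Apply \<open>avoidable\<close> to the restrictions to \<open>{a..b}\<close>: a point
  outside their bodies continues \<open>x\<close> from \<open>a\<close> on so that all pieces are
  avoided by level \<open>b\<close>.\<close>

lemma escape:
  assumes av: "avoidable p k" and X: "adm k X" "\<And>t. t \<in> X \<Longrightarrow> cls t < p" and x: "x \<in> points"
    and hle: "\<And>t. t \<in> X \<Longrightarrow> h (lev t) \<le> h (lev t \<inter> {a..b}) + r"
    and K: "\<And>l. k \<le> l \<Longrightarrow> (1 + slack l) ^ r \<le> K"
    and small: "K * wt X < capacity k"
  obtains y where "y \<in> points" "\<And>t. t \<in> X \<Longrightarrow> kills b (graft a x y) (body t)"
proof -
  have "K * wt X < 32" using small capacity_less[of k] by simp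
  note ri = rest_image[OF X(1) x hle K this]
  have "\<forall>t\<in>rest x a b ` X. cls t < p" using X(2) by auto
  moreover have "wt (rest x a b ` X) < capacity k" using ri(2) small by linarith
  ultimately have "\<exists>z\<in>points. \<forall>t\<in>rest x a b ` X. z \<notin> body t"
    using av ri(1) unfolding avoidable_def by blast
  then obtain z where "z \<in> points" "\<And>t. t \<in> X \<Longrightarrow> z \<notin> body (rest x a b t)" by auto
  then show thesis using that[of z] by auto
qed

text \<open>
  The coordinates below \<open>a\<close> are already chosen, and \<open>r\<close> bounds the norm that the pieces in \<open>X\<close> have
  lost so far. The piece \<open>y\<close> of class \<open>k\<close> that first has 33 levels from \<open>a\<close> on is avoided in one of the
  32 gaps between these levels. A piece of \<open>X\<close> must be avoided within the gap only if it keeps most of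
  its norm neither before nor after it; this happens for at most one gap, so that the weight of
  these pieces is small for some gap.
\<close>

lemma avoid_step:
  assumes av: "avoidable p (Suc k)"
    and Y: "finite Y" "card Y = s" "\<And>t. t \<in> Y \<Longrightarrow> good t \<and> cls t = k"
      "\<And>t. t \<in> Y \<Longrightarrow> s * 33 \<le> card (lev t \<inter> {a..})"
    and X: "adm (Suc k) X" "\<And>t. t \<in> X \<Longrightarrow> cls t < p"
      "\<And>t. t \<in> X \<Longrightarrow> h (lev t) \<le> h (lev t \<inter> {a..}) + r"
    and r: "r + 2 * s \<le> 2 ^ (k + 5)" and wX: "wt X < capacity k" and x: "x \<in> points"
  shows "\<exists>z\<in>points. (\<forall>i<a. z i = x i) \<and> (\<forall>t\<in>Y \<union> X. z \<notin> body t)"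
  using Y X r wX x
proof (induction s arbitrary: a x Y X r)
  case 0
  \<comment> \<open>No piece of class \<open>k\<close> is left. With \<open>b\<close> beyond all
    levels, nothing is lost at the upper end, and one application of \<open>escape\<close>
    suffices.\<close>
  have fin: "finite (\<Union>t\<in>X. lev t)" using 0 by (auto simp: adm_def good_finite)
  then obtain b where b: "(\<Union>t\<in>X. lev t) \<subseteq> {..b}" using finite_nat_iff_bounded_le by blast
  have le: "h (lev t) \<le> h (lev t \<inter> {a..b}) + r" if "t \<in> X" for t
  proof -
    have "lev t \<inter> {a..} = lev t \<inter> {a..b}" using b that by auto
    then show ?thesis using 0(7)[OF that] by simp
  qed
  have K: "(1 + slack l) ^ r \<le> exp ((1/2) ^ Suc k)" if "Suc k \<le> l" for l
    using that 0 by (intro slack_power_le) auto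
  have "exp ((1/2) ^ Suc k) * wt X < capacity (Suc k)"
    using 0 by (simp flip: capacity_Suc)
  from escape[OF av 0(5,6) \<open>x \<in> points\<close> le K this] obtain y where
    y: "y \<in> points" "\<And>t. t \<in> X \<Longrightarrow> kills b (graft a x y) (body t)" by blast
  have "graft a x y \<notin> body t" if "t \<in> X" for t
    using not_in_kills[OF y(2)[OF that]] by simp
  moreover have "Y = {}" using 0 by simp
  ultimately show ?case using y(1) 0 by (intro bexI[of _ "graft a x y"]) (auto simp: graft_in_points)
next
  case (Suc s)
  note Y = Suc.prems(1-4) and X = Suc.prems(5-7) and r = Suc.prems(8) and wX = Suc.prems(9) and x = Suc.prems(10)
  have finX: "finite X" using X(1) by (simp add: adm_def)
  define many where "many e t \<longleftrightarrow> 33 \<le> card (lev t \<inter> {a..e})" for e t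
  have "\<exists>e. \<exists>t\<in>Y. many e t"
  proof -
    obtain t where t: "t \<in> Y" using Y(2) by fastforce
    obtain e where "lev t \<subseteq> {..e}" using good_finite Y(3)[OF t] finite_nat_iff_bounded_le by blast
    then have "lev t \<inter> {a..} = lev t \<inter> {a..e}" by auto
    then show ?thesis using Y(4)[OF t] t unfolding many_def by (intro exI[of _ e] bexI[of _ t]) auto
  qed
  define e where "e = (LEAST e. \<exists>t\<in>Y. many e t)"
  have "\<exists>t\<in>Y. many e t" unfolding e_def by (rule LeastI_ex) fact
  then obtain y where y: "y \<in> Y" "33 \<le> card (lev y \<inter> {a..e})" by (auto simp: many_def)
  \<comment> \<open>By minimality of \<open>e\<close>, each piece in \<open>Y\<close> has at most 32
    levels in \<open>{a..<e}\<close>, so \<open>s * 33\<close> of its \<open>Suc s * 33\<close>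
    levels remain.\<close>
  have few: "s * 33 \<le> card (lev t \<inter> {e..})" if "t \<in> Y" for t
  proof -
    have ft: "finite (lev t)" using Y(3)[OF that] good_finite by blast
    have "card (lev t \<inter> {a..<e}) \<le> 32"
    proof (cases e)
      case (Suc e')
      then have "\<not> many e' t" using that not_less_Least[of e' "\<lambda>e. \<exists>t\<in>Y. many e t"] by (auto simp: e_def)
      moreover have "{a..<e} = {a..e'}" using Suc by auto
      ultimately show ?thesis by (simp add: many_def)
    qed simp
    moreover have "card (lev t \<inter> {a..}) \<le> card (lev t \<inter> {a..<e} \<union> lev t \<inter> {e..})"
      using ft by (intro card_mono) auto
    moreover have "\<dots> \<le> card (lev t \<inter> {a..<e}) + card (lev t \<inter> {e..})" by (rule card_Un_le)
    ultimately show ?thesis using Y(4)[OF that] by simp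
  qed
  have fy: "finite (lev y)" and gy: "good y" and cy: "cls y = k" using Y(3)[OF y(1)] good_finite by blast+
  have "32 < card (lev y \<inter> {a..e})" using y(2) by simp
  then obtain j :: "nat \<Rightarrow> nat" where j: "\<And>q. q \<le> 32 \<Longrightarrow> j q \<in> lev y \<inter> {a..e}" "\<And>p q. p < q \<Longrightarrow> q \<le> 32 \<Longrightarrow> j p < j q"
    using enumerate_levels[OF finite_Int[OF disjI1[OF fy]]] by blast
  \<comment> \<open>Isolating an interval takes at most two cuts, hence two units beyond
    \<open>r\<close>.\<close>
  define ok where "ok S t \<longleftrightarrow> h (lev t) \<le> h (lev t \<inter> S) + (r + 2)" for S t
  have ok_mono: "ok S' t" if "ok S t" "S \<subseteq> S'" "t \<in> X" for S S' t
  proof -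
    have "finite (lev t)" using that X(1) by (auto simp: adm_def good_finite)
    then have "h (lev t \<inter> S) \<le> h (lev t \<inter> S')" using that by (intro norm_mono) auto
    then show ?thesis using that by (simp add: ok_def)
  qed
  have ok_split: "ok {a..m} t \<or> ok {m..n} t \<or> ok {n..} t" if "t \<in> X" "a \<le> m" "m \<le> n" for m n t
  proof -
    have ft: "finite (lev t)" using that X(1) by (auto simp: adm_def good_finite)
    have e1: "lev t \<inter> {a..} \<inter> {..m} = lev t \<inter> {a..m}" "lev t \<inter> {a..} \<inter> {m..} = lev t \<inter> {m..}"
      "lev t \<inter> {m..} \<inter> {..n} = lev t \<inter> {m..n}" "lev t \<inter> {m..} \<inter> {n..} = lev t \<inter> {n..}" 
      using that by auto
    have "h (lev t \<inter> {a..}) \<le> Suc (h (lev t \<inter> {a..m})) \<or> h (lev t \<inter> {a..}) \<le> Suc (h (lev t \<inter> {m..}))"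
      using norm_cut_point[of "lev t \<inter> {a..}" m] ft unfolding e1 by simp
    moreover have "h (lev t \<inter> {m..}) \<le> Suc (h (lev t \<inter> {m..n})) \<or> h (lev t \<inter> {m..}) \<le> Suc (h (lev t \<inter> {n..}))"
      using norm_cut_point[of "lev t \<inter> {m..}" n] ft unfolding e1 by simp
    ultimately show ?thesis using X(3)[OF that(1)] unfolding ok_def by linarith
  qed
  define Z where "Z q = {t\<in>X. \<not> ok {a..j q} t \<and> \<not> ok {j (Suc q)..} t}" for q :: nat
  \<comment> \<open>By \<open>ok_split\<close>, a piece in \<open>Z p\<close> keeps its norm on gap
    \<open>p\<close>, and this gap lies in \<open>{a..j q}\<close> for every later
    \<open>q\<close>.\<close>
  have disj: "Z p \<inter> Z q = {}" if "p < q" "q < 32" for p q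
  proof -
    have "ok {a..j q} t" if t: "t \<in> Z p" for t
    proof -
      have "a \<le> j p" "j p \<le> j (Suc p)" "j (Suc p) \<le> j q" 
        using j(1)[of p] j(2)[of p "Suc p"] j(2)[of "Suc p" q] \<open>p < q\<close> \<open>q < 32\<close>
        by (cases "Suc p = q"; simp)+
      moreover have "ok {j p..j (Suc p)} t" using t ok_split[of t "j p" "j (Suc p)"] calculation by (auto simp: Z_def)
      ultimately show ?thesis using ok_mono[of "{j p..j (Suc p)}" t] t by (force simp: Z_def)
    qed
    then show ?thesis by (auto simp: Z_def)
  qed
  \<comment> \<open>Otherwise 32 disjoint subfamilies of weight above 1/2 would weigh at least 16,
    more than \<open>capacity k\<close>.\<close>
  have "\<exists>q<32. wt (Z q) \<le> 1/2"
  proof (rule ccontr)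
    assume "\<not> ?thesis"
    then have gt: "1/2 < wt (Z q)" if "q < 32" for q using that by force
    have "16 = (\<Sum>q<(32::nat). 1/2::real)" by simp
    also have "\<dots> \<le> (\<Sum>q<32. wt (Z q))" using gt by (intro sum_mono) (auto intro: less_imp_le)
    also have "\<dots> = wt (\<Union>q<32. Z q)"
      unfolding wt_def
    proof (rule sum.UNION_disjoint[symmetric])
      show "\<forall>i\<in>{..<32}. \<forall>j\<in>{..<32}. i \<noteq> j \<longrightarrow> Z i \<inter> Z j = {}"
        using disj by (metis Int_commute lessThan_iff linorder_neqE_nat)
    qed (use finX in \<open>auto simp: Z_def\<close>)
    also have "\<dots> \<le> wt X" by (intro wt_mono finX) (auto simp: Z_def)
    finally show False using wX capacity_less[of k] by simp
  qed
  then obtain q where q: "q < 32" "wt (Z q) \<le> 1/2" by blast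
  define m n where "m = j q" and "n = j (Suc q)"
  have mn: "m \<in> lev y" "n \<in> lev y" "m < n" "a \<le> m" "n \<le> e"
    using j(1)[of q] j(1)[of "Suc q"] j(2)[of q "Suc q"] q(1) by (auto simp: m_def n_def)
  \<comment> \<open>\<open>X1\<close> is avoided before the gap, \<open>X3\<close> together with
    \<open>y\<close> inside it, and \<open>X2\<close> is passed on beyond it.\<close>
  define X1 X2 X3 where "X1 = {t\<in>X. ok {a..m} t}" and "X2 = {t\<in>X - X1. ok {n..} t}" and "X3 = Z q"
  have X123: "X = X1 \<union> X2 \<union> X3" by (auto simp: X1_def X2_def X3_def Z_def m_def n_def)
  have sub: "X1 \<subseteq> X" "X2 \<subseteq> X" "X3 \<subseteq> X" using X123 by auto
  have adm: "adm (Suc k) X1" "adm (Suc k) X2" "adm (Suc k) X3"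
    using X(1) sub finite_subset[of _ X] by (auto simp: adm_def)
  have K: "(1 + slack l) ^ (r + 2) \<le> exp ((1/2) ^ Suc k)" if "Suc k \<le> l" for l
    using that r by (intro slack_power_le) auto
  have "exp ((1/2) ^ Suc k) * wt X1 < capacity (Suc k)"
    using wX wt_mono[OF finX sub(1)] by (simp flip: capacity_Suc)
  then obtain u where u: "u \<in> points" "\<And>t. t \<in> X1 \<Longrightarrow> kills m (graft a x u) (body t)"
    using escape[OF av adm(1) _ x _ K, of a m] X(2) sub by (auto simp: X1_def ok_def)
  define x1 where "x1 = graft a x u"
  have x1: "x1 \<in> points" using x u by (simp add: x1_def graft_in_points)
  have le3: "h (lev t) \<le> h (lev t \<inter> {m..n}) + (r + 2)" if "t \<in> X3" for t
    using that ok_split[of t m n] mn by (auto simp: X3_def Z_def ok_def m_def n_def)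
  \<comment> \<open>A factor below 2 turns 1/2 into the bound 1 that goodness of \<open>y\<close>
    demands.\<close>
  have w3: "exp ((1/2) ^ Suc k) * wt X3 < 1"
  proof -
    have "exp ((1/2) ^ Suc k) * wt X3 \<le> exp ((1/2) ^ Suc k) * (1/2)"
      using q(2) by (intro mult_left_mono) (auto simp: X3_def)
    then show ?thesis using exp_half_power_less_2[of k] by linarith
  qed
  have ri: "adm (Suc k) (rest x1 m n ` X3)" "wt (rest x1 m n ` X3) < 1"
    using rest_image[OF adm(3) x1 le3 K] w3 by auto
  have lv: "\<And>t. t \<in> rest x1 m n ` X3 \<Longrightarrow> lev t \<subseteq> {..n}" by auto
  obtain v where v: "v \<in> points" "kills n (graft m x1 v) (body y)" 
    "\<And>t. t \<in> rest x1 m n ` X3 \<Longrightarrow> v \<notin> body t"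
    using good_thin[OF gy mn(1-3) x1 ri(1)[folded cy] lv ri(2)] by blast
  define x2 where "x2 = graft m x1 v"
  have x2: "x2 \<in> points" using x1 v by (simp add: x2_def graft_in_points)
  have "\<exists>z\<in>points. (\<forall>i<n. z i = x2 i) \<and> (\<forall>t\<in>(Y - {y}) \<union> X2. z \<notin> body t)"
  proof (rule Suc.IH)
    show "s * 33 \<le> card (lev t \<inter> {n..})" if "t \<in> Y - {y}" for t
    proof -
      have "card (lev t \<inter> {e..}) \<le> card (lev t \<inter> {n..})"
        using that Y(3)[of t] mn(5) good_finite by (intro card_mono) auto
      then show ?thesis using few[of t] that by simp
    qed
    show "h (lev t) \<le> h (lev t \<inter> {n..}) + (r + 2)" if "t \<in> X2" for t
      using that by (simp add: X2_def ok_def)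
    show "wt X2 < capacity k" using wX wt_mono[OF finX sub(2)] by simp
  qed (use Y adm X(2) sub r x2 y(1) in auto)
  then obtain z where z: "z \<in> points" "\<And>i. i < n \<Longrightarrow> z i = x2 i" "\<And>t. t \<in> (Y - {y}) \<union> X2 \<Longrightarrow> z \<notin> body t"
    by blast
  have zm: "z i = graft a x u i" if "i < m" for i using z(2)[of i] that mn(3) by (simp add: x2_def x1_def)
  have "z \<notin> body t" if "t \<in> Y \<union> X" for t
  proof -
    consider "t \<in> (Y - {y}) \<union> X2" | "t = y" | "t \<in> X1" | "t \<in> X3"
      using \<open>t \<in> Y \<union> X\<close> X123 by blast
    then show ?thesis
    proof cases
      case 1
      then show ?thesis by (rule z(3))
    next
      case 2
      then show ?thesis using not_in_kills[OF v(2)] z(2) by (simp add: x2_def)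
    next
      case 3
      then show ?thesis using not_in_kills[OF u(2)] zm by blast
    next
      case 4
      then have "v \<notin> body (rest x1 m n t)" using v(3) by blast
      then have "kills n x2 (body t)" using v(1) by (simp add: x2_def)
      then show ?thesis using not_in_kills z(2) by blast
    qed
  qed
  moreover have "z i = x i" if "i < a" for i using zm[of i] that mn(4) by simp
  ultimately show ?case using z(1) by blast
qed

text \<open>Downward induction on \<open>k\<close>. Each piece of class \<open>k\<close> weighs at
  least \<open>(1/2) ^ k\<close>, so there are at most \<open>16 * 2 ^ k\<close> of them; each has
  more than \<open>min_norm k = 1024 * 2 ^ k\<close> levels, enough for 33 levels per such
  piece.\<close>

lemma avoidable: "avoidable p k"
proof (induction "p - k" arbitrary: k)
  case 0
  show ?case
    unfolding avoidable_def
  proof (intro allI impI)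
    fix X assume "adm k X \<and> (\<forall>t\<in>X. cls t < p) \<and> wt X < capacity k"
    then have "X = {}" using 0 by (fastforce simp: adm_def)
    then show "\<exists>z\<in>points. \<forall>t\<in>X. z \<notin> body t" using zero_in_points by blast
  qed
next
  case (Suc d)
  then have av: "avoidable p (Suc k)" by simp
  show ?case
    unfolding avoidable_def
  proof (intro allI impI)
    fix X assume "adm k X \<and> (\<forall>t\<in>X. cls t < p) \<and> wt X < capacity k"
    then have X: "adm k X" "\<And>t. t \<in> X \<Longrightarrow> cls t < p" "wt X < capacity k" by auto
    have fin: "finite X" using X(1) by (simp add: adm_def)
    define Y X' where "Y = {t\<in>X. cls t = k}" and "X' = {t\<in>X. k < cls t}"
    have XY: "X = Y \<union> X'" using X(1) by (auto simp: Y_def X'_def adm_def le_less)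
    have "of_nat (card Y) * (1/2) ^ k \<le> wt Y"
      unfolding wt_def using weight_ge[of k] by (intro sum_bounded_below) (auto simp: Y_def wgt_def)
    also have "\<dots> < 16" using wt_mono[OF fin, of Y] X(3) capacity_less[of k] by (simp add: Y_def)
    finally have "real (card Y) < real (16 * 2 ^ k)" by (simp add: power_divide field_simps)
    then have cY: "card Y \<le> 16 * 2 ^ k" by linarith
    have "\<exists>z\<in>points. (\<forall>i<0. z i = (\<lambda>_. 0) i) \<and> (\<forall>t\<in>Y \<union> X'. z \<notin> body t)"
    proof (rule avoid_step[OF av])
      show "good t \<and> cls t = k" if "t \<in> Y" for t using that X(1) by (auto simp: Y_def adm_def)
      show "card Y * 33 \<le> card (lev t \<inter> {0..})" if t: "t \<in> Y" for t
      proof -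
        have "t \<in> X" "good t" "cls t = k" using t X(1) by (auto simp: Y_def adm_def)
        then have "weight k (lev t) < 32"
          using wgt_le_wt[OF fin, of t] X(3) capacity_less[of k] by (simp add: wgt_def)
        then have "min_norm k < card (lev t)" using card_large good_finite \<open>good t\<close> by blast
        moreover have "card Y * 33 \<le> min_norm k" using cY by (simp add: min_norm_def power_add)
        ultimately show ?thesis by (simp add: atLeast_0)
      qed
      show "adm (Suc k) X'" using X(1) by (auto simp: X'_def adm_def)
      show "0 + 2 * card Y \<le> 2 ^ (k + 5)" using cY by (simp add: power_add)
      show "wt X' < capacity k" using wt_mono[OF fin, of X'] X(3) by (simp add: X'_def)
      show "h (lev t) \<le> h (lev t \<inter> {0..}) + 0" for t by (simp add: atLeast_0)
      show "finite Y" using fin by (simp add: Y_def)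
      show "cls t < p" if "t \<in> X'" for t using that X(2) by (simp add: X'_def)
    qed (simp_all add: zero_in_points)
    then show "\<exists>z\<in>points. \<forall>t\<in>X. z \<notin> body t" using XY by blast
  qed
qed

text \<open>The case of one lost unit of norm, with the crude factor
  \<open>1 + slack l \<le> 2\<close>.\<close>

lemma escape':
  assumes X: "adm k X" and x: "x \<in> points"
    and hle: "\<And>t. t \<in> X \<Longrightarrow> h (lev t) \<le> Suc (h (lev t \<inter> {a..b}))"
    and small: "2 * wt X < capacity k"
  obtains y where "y \<in> points" "\<And>t. t \<in> X \<Longrightarrow> kills b (graft a x y) (body t)"
proof -
  have p: "cls t < Suc (Max (cls ` X))" if "t \<in> X" for t
    using that X by (auto simp: adm_def less_Suc_eq_le)
  have hle': "h (lev t) \<le> h (lev t \<inter> {a..b}) + 1" if "t \<in> X" for t using hle[OF that] by simp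
  have "(1 + slack l) ^ 1 \<le> 2" for l using slack_le_1[of l] by simp
  from escape[OF avoidable X p x hle' this small] that show thesis by blast
qed

lemma rest_image':
  assumes X: "adm k X" and x: "x \<in> points"
    and hle: "\<And>t. t \<in> X \<Longrightarrow> h (lev t) \<le> Suc (h (lev t \<inter> {a..b}))"
    and small: "2 * wt X < 32"
  shows "adm k (rest x a b ` X)" "wt (rest x a b ` X) \<le> 2 * wt X"
proof -
  have "h (lev t) \<le> h (lev t \<inter> {a..b}) + 1" if "t \<in> X" for t using hle[OF that] by simp
  moreover have "(1 + slack l) ^ 1 \<le> 2" for l using slack_le_1[of l] by simp
  ultimately show "adm k (rest x a b ` X)" "wt (rest x a b ` X) \<le> 2 * wt X"
    using rest_image[OF X x _ _ small, of a b 1] by blast+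
qed

section \<open>Covers, and cylinders over members of \<open>F\<close>\<close>

definition cov :: "nat \<Rightarrow> real \<Rightarrow> (nat \<Rightarrow> nat) set \<Rightarrow> bool" where
  "cov k v A \<longleftrightarrow> (\<exists>X. adm k X \<and> wt X \<le> v \<and> A \<subseteq> (\<Union>t\<in>X. body t))"

text \<open>Induction on \<open>J\<close> from its least element \<open>n\<close>. Pieces with
  almost all their norm in \<open>{a..n}\<close> are avoided below \<open>n\<close>. For the others
  the set \<open>K\<close>, not separated by \<open>n\<close>, must lie beyond \<open>n\<close>. The
  same \<open>K\<close> serves to the end, so the loss is one unit in total and not one for each
  point of \<open>J\<close>.\<close>

lemma cylinder_avoid:
  assumes "finite J" "J \<subseteq> {a..}" "adm 0 X" "wt X < 1" "x \<in> points"
    and "\<And>t. t \<in> X \<Longrightarrow> \<exists>K\<subseteq>lev t. K \<subseteq> {a..} \<and> (\<forall>j\<in>J. K \<subseteq> {..j} \<or> K \<subseteq> {j<..}) \<and> h (lev t) \<le> Suc (h K)"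
  shows "\<exists>z\<in>points. (\<forall>i<a. z i = x i) \<and> (\<forall>i\<in>J. z i = x i) \<and> (\<forall>t\<in>X. z \<notin> body t)"
  using assms
proof (induction J arbitrary: a x X rule: finite_linorder_min_induct)
  case empty
  have "finite (\<Union>t\<in>X. lev t)" using empty by (auto simp: adm_def good_finite)
  then obtain b where b: "(\<Union>t\<in>X. lev t) \<subseteq> {..b}" using finite_nat_iff_bounded_le by blast
  have le: "h (lev t) \<le> Suc (h (lev t \<inter> {a..b}))" if t: "t \<in> X" for t
  proof -
    obtain K where K: "K \<subseteq> lev t" "K \<subseteq> {a..}" "h (lev t) \<le> Suc (h K)" using empty(5)[OF t] by blast
    have "lev t \<subseteq> {..b}" using b t by blast
    moreover have "{a..} \<inter> {..b} = {a..b}" by auto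
    ultimately have "K \<subseteq> lev t \<inter> {a..b}" using K by blast
    then have "h K \<le> h (lev t \<inter> {a..b})"
      using t empty(2) by (intro norm_mono) (auto simp: adm_def good_finite)
    then show ?thesis using K by simp
  qed
  have "2 * wt X < capacity 0" using empty(3) capacity_gt[of 0] by simp
  then obtain y where y: "y \<in> points" "\<And>t. t \<in> X \<Longrightarrow> kills b (graft a x y) (body t)"
    using escape'[OF empty(2,4) le] by blast
  have "graft a x y \<notin> body t" if "t \<in> X" for t
    using not_in_kills[OF y(2)[OF that]] by simp
  then show ?case using y empty(4) by (intro bexI[of _ "graft a x y"]) (auto simp: graft_in_points)
next
  case (insert n J)
  have an: "a \<le> n" using insert.prems(1) by simp
  have fin: "finite X" using insert.prems(2) by (simp add: adm_def)
  have ft: "finite (lev t)" if "t \<in> X" for t using that insert.prems(2) by (auto simp: adm_def good_finite)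
  define X1 X2 where "X1 = {t\<in>X. h (lev t) \<le> Suc (h (lev t \<inter> {a..n}))}"
    and "X2 = X - X1"
  have sub: "X1 \<subseteq> X" "X2 \<subseteq> X" by (auto simp: X1_def X2_def)
  have "finite X1" "finite X2" using fin by (simp_all add: X1_def X2_def)
  then have adm: "adm 0 X1" "adm 0 X2" using insert.prems(2) by (simp_all add: adm_def X1_def X2_def)
  have hle1: "h (lev t) \<le> Suc (h (lev t \<inter> {a..n}))" if "t \<in> X1" for t
    using that by (simp add: X1_def)
  have "2 * wt X1 < capacity 0"
    using wt_mono[OF fin sub(1)] insert.prems(3) capacity_gt[of 0] by simp
  then obtain y where y: "y \<in> points" "\<And>t. t \<in> X1 \<Longrightarrow> kills n (graft a x y) (body t)"
    using escape'[OF adm(1) insert.prems(4) hle1] by blast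
  \<comment> \<open>Agrees with the avoiding point below \<open>n\<close> and with \<open>x\<close>
    from \<open>n\<close> on, so the prescribed values at \<open>n\<close> and on \<open>J\<close>
    survive.\<close>
  define x1 where "x1 = graft n (graft a x y) x"
  have "\<exists>z\<in>points. (\<forall>i<Suc n. z i = x1 i) \<and> (\<forall>i\<in>J. z i = x1 i) \<and> (\<forall>t\<in>X2. z \<notin> body t)"
  proof (rule insert.IH)
    show "J \<subseteq> {Suc n..}" using insert.hyps(2) by (auto simp: Suc_le_eq)
    show "wt X2 < 1" using wt_mono[OF fin sub(2)] insert.prems(3) by simp
    show "x1 \<in> points" using y insert.prems(4) by (simp add: x1_def graft_in_points)
    fix t assume t: "t \<in> X2"
    then have "t \<in> X" by (simp add: X2_def)
    from insert.prems(5)[OF this] obtain K where K: "K \<subseteq> lev t" "K \<subseteq> {a..}"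
      "\<forall>j\<in>insert n J. K \<subseteq> {..j} \<or> K \<subseteq> {j<..}" "h (lev t) \<le> Suc (h K)" by blast
    have "\<not> K \<subseteq> {..n}"
    proof
      assume "K \<subseteq> {..n}"
      moreover have "{a..} \<inter> {..n} = {a..n}" by auto
      ultimately have "K \<subseteq> lev t \<inter> {a..n}" using K(1,2) by blast
      then have "h K \<le> h (lev t \<inter> {a..n})" using ft[of t] t by (intro norm_mono) (auto simp: X2_def)
      then show False using t K(4) by (simp add: X2_def X1_def)
    qed
    then have "K \<subseteq> {Suc n..}" using K(3) by (simp add: atLeast_Suc_greaterThan)
    then show "\<exists>K\<subseteq>lev t. K \<subseteq> {Suc n..} \<and> (\<forall>j\<in>J. K \<subseteq> {..j} \<or> K \<subseteq> {j<..}) \<and> h (lev t) \<le> Suc (h K)"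
      using K by (intro exI[of _ K]) simp
  qed (rule adm(2))
  then obtain z where z: "z \<in> points" "\<And>i. i < Suc n \<Longrightarrow> z i = x1 i" "\<And>i. i \<in> J \<Longrightarrow> z i = x1 i"
    "\<And>t. t \<in> X2 \<Longrightarrow> z \<notin> body t" by auto
  have zn: "z i = graft a x y i" if "i < n" for i using z(2)[of i] that by (simp add: x1_def)
  have "z \<notin> body t" if "t \<in> X" for t
  proof (cases "t \<in> X1")
    case True
    then show ?thesis using not_in_kills[OF y(2)] zn by blast
  qed (use that z(4) in \<open>auto simp: X2_def\<close>)
  moreover have "z i = x i" if "i < a" for i using zn[of i] that an by simp
  moreover have "z i = x i" if "i \<in> insert n J" for i
    using that z(2)[of n] z(3)[of i] insert.hyps(2) by (auto simp: x1_def)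
  ultimately show ?case using z(1) by blast
qed

lemma cylinder_not_cov:
  assumes J: "J \<in> F" and x: "x \<in> points" and v: "v < 1"
  shows "\<not> cov 0 v {z \<in> points. \<forall>i\<in>J. z i = x i}"
proof
  assume "cov 0 v {z \<in> points. \<forall>i\<in>J. z i = x i}"
  then obtain X where X: "adm 0 X" "wt X \<le> v" "{z \<in> points. \<forall>i\<in>J. z i = x i} \<subseteq> (\<Union>t\<in>X. body t)"
    by (auto simp: cov_def)
  have "\<exists>K\<subseteq>lev t. K \<subseteq> {0..} \<and> (\<forall>j\<in>J. K \<subseteq> {..j} \<or> K \<subseteq> {j<..}) \<and> h (lev t) \<le> Suc (h K)" if "t \<in> X" for t
    using norm_cut[OF J, of "lev t"] that X(1) by (auto simp: adm_def good_finite atLeast_0)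
  from cylinder_avoid[OF family_finite[OF J] _ X(1) _ x this] X(2) v
  obtain z where "z \<in> points" "\<forall>i\<in>J. z i = x i" "\<forall>t\<in>X. z \<notin> body t" by (auto simp: atLeast_0)
  then show False using X(3) by blast
qed

end

section \<open>Exhaustivity\<close>

lemma dep_mono: "dep n A \<Longrightarrow> n \<le> n' \<Longrightarrow> dep n' A"
  unfolding dep_def by (meson less_le_trans)

lemma dep_UN: "(\<And>i. i \<in> S \<Longrightarrow> dep n (A i)) \<Longrightarrow> dep n (\<Union>i\<in>S. A i)"
  unfolding dep_def by blast

lemma dep_Diff: "dep n A \<Longrightarrow> dep n (points - A)"
  unfolding dep_def
proof (intro ballI impI DiffI notI)
  fix y z assume *: "\<forall>y\<in>A. \<forall>z\<in>points. (\<forall>i<n. z i = y i) \<longrightarrow> z \<in> A"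
    and y: "y \<in> points - A" and eq: "\<forall>i<n. z i = y i" and z: "z \<in> A"
  have "\<forall>i<n. y i = z i" using eq by simp
  then have "y \<in> A" using * y z by blast
  then show False using y by blast
qed

lemma ind_UN: "(\<And>i. i \<in> S \<Longrightarrow> ind m (A i)) \<Longrightarrow> ind m (\<Union>i\<in>S. A i)"
  unfolding ind_def by blast

lemma ind_Diff: "ind m A \<Longrightarrow> ind m (points - A)"
  unfolding ind_def
proof (intro ballI impI DiffI notI)
  fix y z assume *: "\<forall>y\<in>A. \<forall>z\<in>points. (\<forall>i\<ge>m. z i = y i) \<longrightarrow> z \<in> A"
    and y: "y \<in> points - A" and eq: "\<forall>i\<ge>m. z i = y i" and z: "z \<in> A"
  have "\<forall>i\<ge>m. y i = z i" using eq by simp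
  then have "y \<in> A" using * y z by blast
  then show False using y by blast
qed

abbreviation trunc :: "nat \<Rightarrow> (nat \<Rightarrow> nat) \<Rightarrow> nat \<Rightarrow> nat" where
  "trunc n x \<equiv> graft n x (\<lambda>_. 0)"

lemma trunc_cong: "(\<And>i. i < n \<Longrightarrow> x i = y i) \<Longrightarrow> trunc n x = trunc n y"
  by (auto simp: graft_def fun_eq_iff)

lemma finite_trunc: "finite (trunc n ` points)"
proof (rule finite_subset)
  have "x i < 2 ^ n" if "x \<in> points" "i < n" for x i
    using that less_trans[of "x i" "2 ^ i" "2 ^ n"] by (simp add: points_def)
  then show "trunc n ` points \<subseteq> {f. \<forall>i. (i \<in> {..<n} \<longrightarrow> f i \<in> {..<2 ^ n}) \<and> (i \<notin> {..<n} \<longrightarrow> f i = 0)}"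
    by auto
qed (intro finite_set_of_finite_funs finite_lessThan)

lemma dep_trunc:
  assumes "dep n U" "U \<subseteq> points"
  shows "U = {x \<in> points. trunc n x \<in> trunc n ` U}"
proof (intro equalityI subsetI)
  fix x assume "x \<in> {x \<in> points. trunc n x \<in> trunc n ` U}"
  then obtain y where y: "x \<in> points" "y \<in> U" "trunc n x = trunc n y" by auto
  have "x i = y i" if "i < n" for i using fun_cong[OF y(3), of i] that by simp
  then show "x \<in> U" using assms(1) y unfolding dep_def by blast
qed (use assms in auto)

text \<open>Such a set is determined by the truncations of its points, of which there are finitely
  many.\<close>

lemma finite_dep: "finite {U. U \<subseteq> points \<and> dep n U}"
proof (rule finite_subset)
  show "{U. U \<subseteq> points \<and> dep n U} \<subseteq> (\<lambda>V. {x \<in> points. trunc n x \<in> V}) ` Pow (trunc n ` points)"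
  proof
    fix U assume "U \<in> {U. U \<subseteq> points \<and> dep n U}"
    then have U: "U \<subseteq> points" "dep n U" by auto
    then have "trunc n ` U \<in> Pow (trunc n ` points)" by auto
    with dep_trunc[OF U(2,1)] show "U \<in> (\<lambda>V. {x \<in> points. trunc n x \<in> V}) ` Pow (trunc n ` points)"
      by (rule image_eqI)
  qed
qed (intro finite_imageI, simp add: finite_trunc)

text \<open>The hull of the body at level \<open>n\<close>: all points that agree below
  \<open>n\<close> with some element of the body.\<close>

definition outer :: "nat \<Rightarrow> piece \<Rightarrow> (nat \<Rightarrow> nat) set" where
  "outer n t = {y \<in> points. \<not> kills n y (body t)}"

lemma outer_antimono: "n \<le> n' \<Longrightarrow> outer n' t \<subseteq> outer n t"
  unfolding outer_def using kills_mono[OF _ _ subset_refl] by blast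

lemma dep_outer: "dep n (outer n t)"
  unfolding dep_def outer_def
proof (intro ballI impI CollectI conjI)
  fix y z assume "y \<in> {y \<in> points. \<not> kills n y (body t)}" and "\<forall>i<n. z i = y i"
  then show "\<not> kills n z (body t)" using kills_cong[of n z y "body t"] by simp
qed

lemma ind_outer:
  assumes "ind m (body t)" "body t \<subseteq> points"
  shows "ind m (outer n t)"
  unfolding ind_def
proof (intro ballI impI)
  fix y y' assume y: "y \<in> outer n t" and y': "y' \<in> points" and eq: "\<forall>i\<ge>m. y' i = y i"
  from y obtain z where z: "z \<in> body t" "\<And>i. i < n \<Longrightarrow> z i = y i"
    by (auto simp: outer_def kills_def)
  \<comment> \<open>Changing \<open>y\<close> below \<open>m\<close> is matched by the same change
    of the witness \<open>z\<close>.\<close>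
  have "graft m y' z \<in> body t"
  proof -
    have "graft m y' z \<in> points" using assms(2) z(1) y' by (auto intro: graft_in_points)
    moreover have "\<forall>i\<ge>m. graft m y' z i = z i" by simp
    ultimately show ?thesis using assms(1) z(1) unfolding ind_def by blast
  qed
  moreover have "graft m y' z i = y' i" if "i < n" for i
    using z(2)[OF that] eq by (cases "i < m") auto
  ultimately show "y' \<in> outer n t" using y' by (auto simp: outer_def kills_def)
qed

context norm_family
begin

section \<open>Calculus of covers\<close>

lemma adm_subset: "adm k X \<Longrightarrow> Y \<subseteq> X \<Longrightarrow> adm k Y"
  unfolding adm_def using finite_subset by blast

lemma adm_lev_bounded:
  assumes "adm k X"
  obtains b where "n \<le> b" "\<And>t. t \<in> X \<Longrightarrow> lev t \<subseteq> {..b}"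
proof -
  have "finite (\<Union>t\<in>X. lev t)" using assms by (auto simp: adm_def good_finite)
  then obtain b where b: "(\<Union>t\<in>X. lev t) \<subseteq> {..b}" using finite_nat_iff_bounded_le by blast
  have "lev t \<subseteq> {..max n b}" if "t \<in> X" for t
  proof -
    have "lev t \<subseteq> {..b}" using b that by blast
    then show ?thesis by (rule order_trans) simp
  qed
  then show thesis using that[of "max n b"] by simp
qed

lemma cov_mono: "cov k v A \<Longrightarrow> v \<le> w \<Longrightarrow> B \<subseteq> A \<Longrightarrow> cov k w B"
  unfolding cov_def by (meson order_trans)

lemma cov_antimono_class: "cov k v A \<Longrightarrow> k' \<le> k \<Longrightarrow> cov k' v A"
  unfolding cov_def adm_def by (meson order_trans)

lemma cov_empty: "0 \<le> v \<Longrightarrow> cov k v {}"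
  unfolding cov_def by (intro exI[of _ "{}"]) (simp add: adm_def)

lemma cov_Un:
  assumes "cov k v A" "cov k w B"
  shows "cov k (v + w) (A \<union> B)"
proof -
  obtain X Y where X: "adm k X" "wt X \<le> v" "A \<subseteq> (\<Union>t\<in>X. body t)"
    and Y: "adm k Y" "wt Y \<le> w" "B \<subseteq> (\<Union>t\<in>Y. body t)"
    using assms unfolding cov_def by blast
  have "adm k (X \<union> Y)" using X(1) Y(1) by (auto simp: adm_def)
  moreover have "wt (X \<union> Y) \<le> v + w"
    using wt_Un_le[of X Y] X(1,2) Y(1,2) by (simp add: adm_def)
  moreover have "A \<union> B \<subseteq> (\<Union>t\<in>X \<union> Y. body t)" using X(3) Y(3) by auto
  ultimately show ?thesis unfolding cov_def by blast
qed

lemma cov_UN: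
  assumes "finite S" "\<And>i. i \<in> S \<Longrightarrow> cov k (v i) (A i)"
  shows "cov k (\<Sum>i\<in>S. v i) (\<Union>i\<in>S. A i)"
  using assms by (induction S rule: finite_induct) (simp_all add: cov_empty cov_Un)

text \<open>The number 5 lies below all capacities, so \<open>avoidable\<close> applies with
  \<open>p\<close> above the finitely many classes that occur.\<close>

lemma not_cov_points: "\<not> cov k 5 points"
proof
  assume "cov k 5 points"
  then obtain X where X: "adm k X" "wt X \<le> 5" "points \<subseteq> (\<Union>t\<in>X. body t)"
    unfolding cov_def by blast
  have "\<forall>t\<in>X. cls t < Suc (Max (cls ` X))"
    using X(1) by (auto simp: adm_def less_Suc_eq_le)
  moreover have "wt X < capacity k" using X(2) capacity_gt[of k] by simp
  ultimately have "\<exists>z\<in>points. \<forall>t\<in>X. z \<notin> body t"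
    using avoidable X(1) unfolding avoidable_def by blast
  then show False using X(3) by blast
qed

text \<open>The pieces that lose at most one unit of norm when their levels are cut off at
  \<open>n\<close>.\<close>

definition winners :: "nat \<Rightarrow> piece set \<Rightarrow> piece set" where
  "winners n X = {t \<in> X. h (lev t) \<le> Suc (h (lev t \<inter> {..n}))}"

lemma winners_subset: "winners n X \<subseteq> X"
  by (auto simp: winners_def)

lemma winners_mono:
  assumes "adm k X" "n \<le> n'"
  shows "winners n X \<subseteq> winners n' X"
proof
  fix t assume t: "t \<in> winners n X"
  then have "finite (lev t)" using assms(1) by (auto simp: winners_def adm_def good_finite)
  then have "h (lev t \<inter> {..n}) \<le> h (lev t \<inter> {..n'})" using assms(2) by (intro norm_mono) auto
  then show "t \<in> winners n' X" using t by (simp add: winners_def)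
qed

text \<open>Suppose \<open>x\<close> in \<open>D\<close> lies outside all these hulls. The other
  pieces keep their norm from \<open>n\<close> on, so they can be avoided by changing
  \<open>x\<close> from \<open>n\<close> on. The result is still in \<open>D\<close> but not
  covered.\<close>

lemma cover_winners:
  assumes D: "dep n D" "D \<subseteq> points" and X: "adm k X" "wt X \<le> 2" "D \<subseteq> (\<Union>t\<in>X. body t)"
  shows "D \<subseteq> (\<Union>t\<in>winners n X. outer n t)"
proof (rule ccontr)
  assume "\<not> ?thesis"
  then obtain x where x: "x \<in> D" "\<And>t. t \<in> winners n X \<Longrightarrow> x \<notin> outer n t" by blast
  have xp: "x \<in> points" using x(1) D(2) by blast
  define L where "L = X - winners n X"
  have L: "adm k L" "L \<subseteq> X" using adm_subset[OF X(1)] by (auto simp: L_def)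
  obtain b where b: "n \<le> b" "\<And>t. t \<in> L \<Longrightarrow> lev t \<subseteq> {..b}" using adm_lev_bounded[OF L(1)] by blast
  have hle: "h (lev t) \<le> Suc (h (lev t \<inter> {n..b}))" if t: "t \<in> L" for t
  proof -
    have "finite (lev t)" using t L(1) by (auto simp: adm_def good_finite)
    moreover have "\<not> h (lev t) \<le> Suc (h (lev t \<inter> {..n}))" using t by (simp add: L_def winners_def)
    ultimately have "h (lev t) \<le> Suc (h (lev t \<inter> {n..}))" using norm_cut_point by blast
    moreover have "lev t \<inter> {n..} = lev t \<inter> {n..b}" using b(2)[OF t] by auto
    ultimately show ?thesis by simp
  qed
  have "finite X" using X(1) by (simp add: adm_def)
  then have "2 * wt L < capacity k" using wt_mono[OF _ L(2)] X(2) capacity_gt[of k] by simp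
  then obtain y where y: "y \<in> points" "\<And>t. t \<in> L \<Longrightarrow> kills b (graft n x y) (body t)"
    using escape'[OF L(1) xp hle] by blast
  define z where "z = graft n x y"
  have "z \<in> points" using xp y(1) by (simp add: z_def graft_in_points)
  moreover have "\<forall>i<n. z i = x i" by (simp add: z_def)
  ultimately have "z \<in> D" using D(1) x(1) unfolding dep_def by blast
  then obtain t where t: "t \<in> X" "z \<in> body t" using X(3) by blast
  show False
  proof (cases "t \<in> winners n X")
    case True
    then have "kills n x (body t)" using x(2) xp by (auto simp: outer_def)
    then show False using not_in_kills[of n x "body t" z] t(2) by (simp add: z_def)
  next
    case False
    then have "kills b z (body t)" using t(1) y(2) by (simp add: L_def z_def)
    then show False using not_in_kills[of b z "body t" z] t(2) by simp
  qed
qed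

text \<open>The hull of a winner is the body of its restriction to \<open>{0..n}\<close>, whose
  weight is at most doubled.\<close>

lemma outer_cov:
  assumes X: "adm k X" and Y: "Y \<subseteq> winners n X" "wt Y \<le> v" and v: "v < 16"
  shows "cov k (2 * v) (\<Union>t\<in>Y. outer n t)"
proof -
  have aY: "adm k Y" using adm_subset[OF X] Y(1) winners_subset by blast
  have hle: "h (lev t) \<le> Suc (h (lev t \<inter> {0..n}))" if "t \<in> Y" for t
    using that Y(1) by (auto simp: winners_def atLeast0AtMost)
  have small: "2 * wt Y < 32" using Y(2) v by simp
  have "outer n t \<subseteq> body (rest (\<lambda>_. 0) 0 n t)" for t by (auto simp: outer_def)
  then have "(\<Union>t\<in>Y. outer n t) \<subseteq> (\<Union>t\<in>rest (\<lambda>_. 0) 0 n ` Y. body t)" by blast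
  moreover have "wt (rest (\<lambda>_. 0) 0 n ` Y) \<le> 2 * v"
    using rest_image'(2)[OF aY zero_in_points hle small] Y(2) by simp
  ultimately show ?thesis
    using rest_image'(1)[OF aY zero_in_points hle small] unfolding cov_def by blast
qed

text \<open>Choose \<open>w\<close> so that its coordinates below \<open>m\<close> avoid the pieces
  with their norm up to \<open>m\<close>, and freeze these coordinates to \<open>w\<close>. As
  \<open>B\<close> does not depend on them, the restrictions of the remaining pieces to the levels
  from \<open>m\<close> on cover \<open>B\<close>.\<close>

lemma cov_ind:
  assumes "cov k 1 B" and B: "B \<subseteq> points" "ind m B"
  shows "\<exists>X. adm k X \<and> wt X \<le> 2 \<and> B \<subseteq> (\<Union>t\<in>X. body t) \<and> (\<forall>t\<in>X. body t \<subseteq> points \<and> ind m (body t))"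
proof -
  obtain X where X: "adm k X" "wt X \<le> 1" "B \<subseteq> (\<Union>t\<in>X. body t)"
    using assms(1) unfolding cov_def by blast
  have fin: "finite X" using X(1) by (simp add: adm_def)
  define X1 X2 where "X1 = {t \<in> X. h (lev t) \<le> Suc (h (lev t \<inter> {0..m}))}" and "X2 = X - X1"
  have sub: "X1 \<subseteq> X" "X2 \<subseteq> X" by (auto simp: X1_def X2_def)
  have adm: "adm k X1" "adm k X2" using adm_subset[OF X(1)] sub by auto
  have wle: "wt X1 \<le> 1" "wt X2 \<le> 1" using wt_mono[OF fin] sub X(2) by (meson order_trans)+
  have hle1: "h (lev t) \<le> Suc (h (lev t \<inter> {0..m}))" if "t \<in> X1" for t
    using that by (simp add: X1_def)
  have "2 * wt X1 < capacity k" using wle capacity_gt[of k] by simp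
  then obtain w where w: "w \<in> points" "\<And>t. t \<in> X1 \<Longrightarrow> kills m w (body t)"
    using escape'[OF adm(1) zero_in_points hle1] by auto
  obtain b where b: "m \<le> b" "\<And>t. t \<in> X2 \<Longrightarrow> lev t \<subseteq> {..b}" using adm_lev_bounded[OF adm(2)] by blast
  have hle2: "h (lev t) \<le> Suc (h (lev t \<inter> {m..b}))" if t: "t \<in> X2" for t
  proof -
    have "finite (lev t)" using t adm(2) by (auto simp: adm_def good_finite)
    moreover have "\<not> h (lev t) \<le> Suc (h (lev t \<inter> {..m}))"
      using t by (simp add: X2_def X1_def atLeast0AtMost)
    ultimately have "h (lev t) \<le> Suc (h (lev t \<inter> {m..}))" using norm_cut_point by blast
    moreover have "lev t \<inter> {m..} = lev t \<inter> {m..b}" using b(2)[OF t] by auto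
    ultimately show ?thesis by simp
  qed
  have small: "2 * wt X2 < 32" using wle by simp
  note ri = rest_image'[OF adm(2) w(1) hle2 small]
  have "B \<subseteq> (\<Union>t\<in>rest w m b ` X2. body t)"
  proof
    fix y assume y: "y \<in> B"
    define z where "z = graft m w y"
    have yp: "y \<in> points" using y B(1) by blast
    then have "z \<in> points" using w(1) by (simp add: z_def graft_in_points)
    moreover have "\<forall>i\<ge>m. z i = y i" by (simp add: z_def)
    ultimately have "z \<in> B" using B(2) y unfolding ind_def by blast
    then obtain t where t: "t \<in> X" "z \<in> body t" using X(3) by blast
    have "t \<notin> X1" using not_in_kills[OF w(2), of t z] t(2) by (auto simp: z_def)
    then have "t \<in> X2" using t(1) by (simp add: X2_def)
    moreover have "\<not> kills b z (body t)" using not_in_kills[of b z "body t" z] t(2) by auto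
    then have "y \<in> body (rest w m b t)" using yp by (simp add: z_def)
    ultimately show "y \<in> (\<Union>t\<in>rest w m b ` X2. body t)" by blast
  qed
  moreover have "ind m (body (rest w m b t))" for t
    unfolding ind_def
  proof (intro ballI impI)
    fix y z assume y: "y \<in> body (rest w m b t)" and z: "z \<in> points" "\<forall>i\<ge>m. z i = y i"
    have "graft m w z = graft m w y" using z(2) by (auto simp: graft_def)
    then show "z \<in> body (rest w m b t)" using y z(1) by simp
  qed
  then have "\<forall>t\<in>rest w m b ` X2. body t \<subseteq> points \<and> ind m (body t)" by auto
  moreover have "wt (rest w m b ` X2) \<le> 2" using ri(2) wle by simp
  ultimately show ?thesis using ri(1) by blast
qed

text \<open>
  In the second case of the following proof all the sets \<open>B r\<close> have covers of weight at most 2. A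
  weight that can be gained, uniformly in \<open>r\<close>, by looking at pieces with most of their norm below
  some level \<open>n\<close> is almost gained at a fixed level; there, the pieces in question cover one of
  finitely many sets \<open>U\<close>, and \<open>C\<close> is the complement of \<open>U\<close>.
\<close>

lemma dichotomy:
  fixes B D :: "nat \<Rightarrow> (nat \<Rightarrow> nat) set"
  assumes B: "\<And>r. B r \<subseteq> points" "\<And>r. ind m (B r)" "\<And>r. \<exists>n. dep n (B r)" "mono B"
    and D: "\<And>i. D i \<subseteq> B (Suc i)" "\<And>i. D i \<inter> B i = {}" "\<And>i. \<exists>n. dep n (D i)"
    and e: "e > 0"
  shows "\<exists>C n (i0::nat). C \<subseteq> points \<and> dep n C \<and> ind m C \<and> \<not> cov k 1 C \<and> (\<forall>i\<ge>i0. cov k e (C \<inter> D i))"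
proof (cases "\<forall>r. cov k 1 (B r)")
  \<comment> \<open>Some \<open>B r\<close> itself is large; it is disjoint from all later
    \<open>D i\<close>.\<close>
  case False
  then obtain r where r: "\<not> cov k 1 (B r)" by blast
  obtain n where n: "dep n (B r)" using B(3) by blast
  have "cov k e (B r \<inter> D i)" if "i \<ge> r" for i
  proof -
    have "B r \<inter> D i = {}" using monoD[OF B(4) that] D(2)[of i] by blast
    then show ?thesis using e by (simp add: cov_empty)
  qed
  then show ?thesis using B(1,2) r n by blast
next
  case True
  \<comment> \<open>The number \<open>u\<close> is the weight gained at level \<open>n\<close> by
    the cover \<open>X\<close> of \<open>B r\<close>; \<open>S\<close> collects what a single level
    achieves for all \<open>r\<close>.\<close>
  define P where "P u n r X \<longleftrightarrow> adm k X \<and> wt X \<le> 2 \<and> B r \<subseteq> (\<Union>t\<in>X. body t) \<and>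
    (\<forall>t\<in>X. body t \<subseteq> points \<and> ind m (body t)) \<and> u \<le> wt (winners n X)" for u n r X
  define S where "S = {u. \<exists>n. \<forall>r. \<exists>X. P u n r X}"
  have "0 \<in> S" using cov_ind[OF True[rule_format] B(1,2)] by (auto simp: S_def P_def wt_nonneg)
  have le2: "u \<le> 2" if "u \<in> S" for u
  proof -
    obtain n where "\<forall>r. \<exists>X. P u n r X" using \<open>u \<in> S\<close> by (auto simp: S_def)
    then obtain X where "P u n 0 X" by blast
    then show ?thesis using wt_mono[OF _ winners_subset, of X n] by (auto simp: P_def adm_def)
  qed
  then have bdd: "bdd_above S" by (auto simp: bdd_above_def)
  \<comment> \<open>The choice of \<open>u\<close> this close to the supremum puts
    \<open>u + e / 4\<close> outside \<open>S\<close>.\<close>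
  have "Sup S - e / 8 < Sup S" using e by simp
  then obtain u where u: "u \<in> S" "Sup S - e / 8 < u"
    using less_cSup_iff[OF _ bdd] \<open>0 \<in> S\<close> by blast
  then obtain n where "\<forall>r. \<exists>X. P u n r X" by (auto simp: S_def)
  then obtain X where X: "\<And>r. P u n r (X r)" by metis
  have aX: "adm k (X r)" "wt (X r) \<le> 2" "B r \<subseteq> (\<Union>t\<in>X r. body t)" for r using X[of r] by (auto simp: P_def)
  have fX: "finite (X r)" for r using aX(1) by (simp add: adm_def)
  define U where "U r = (\<Union>t\<in>winners n (X r). outer n t)" for r
  have U: "U r \<subseteq> points" "dep n (U r)" "ind m (U r)" for r
  proof -
    show "U r \<subseteq> points" by (auto simp: U_def outer_def)
    show "dep n (U r)" unfolding U_def by (intro dep_UN dep_outer)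
    show "ind m (U r)" unfolding U_def
      using X[of r] by (intro ind_UN ind_outer) (auto simp: P_def winners_def)
  qed
  have "finite (range U)" using U(1,2) by (intro finite_subset[OF _ finite_dep[of n]]) blast
  then obtain r0 where r0: "infinite {r \<in> UNIV. U r = U r0}"
    using pigeonhole_infinite[of "UNIV :: nat set" U] by auto
  define C where "C = points - U r0"
  \<comment> \<open>A cover of \<open>C\<close> of weight 1, with the winners at doubled weight 4,
    would cover \<open>points\<close> with weight 5.\<close>
  have "\<not> cov k 1 C"
  proof
    assume "cov k 1 C"
    moreover have "cov k (2 * 2) (U r0)"
      unfolding U_def using aX[of r0] wt_mono[OF fX[of r0] winners_subset[of n "X r0"]]
      by (intro outer_cov[of k "X r0"]) simp_all
    ultimately have "cov k (1 + 2 * 2) (C \<union> U r0)" by (rule cov_Un)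
    then have "cov k 5 points" by (rule cov_mono) (simp_all add: C_def subset_iff)
    then show False using not_cov_points by blast
  qed
  moreover have "cov k e (C \<inter> D i)" for i
  proof -
    obtain N where N: "dep N (D i)" using D(3) by blast
    define n' where "n' = max n N"
    \<comment> \<open>Otherwise the covers for these unboundedly many \<open>r\<close> would all
      gain \<open>u + e / 4\<close> at level \<open>n'\<close>. As \<open>B\<close> is increasing,
      they serve for every \<open>B r\<close>, and \<open>u + e / 4\<close> would lie in
      \<open>S\<close>.\<close>
    have "\<exists>r>i. U r = U r0 \<and> wt (winners n' (X r)) < u + e / 4"
    proof (rule ccontr)
      assume contr: "\<not> ?thesis"
      have "\<exists>Y. P (u + e / 4) n' r Y" for r
      proof -
        obtain r' where r': "r' > max r i" "U r' = U r0"
          using r0 unfolding infinite_nat_iff_unbounded by blast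
        have "i < r'" using r'(1) by simp
        then have "u + e / 4 \<le> wt (winners n' (X r'))" using contr r'(2) not_less by blast
        moreover have "B r \<subseteq> B r'" using r'(1) by (intro monoD[OF B(4)]) simp
        ultimately have "P (u + e / 4) n' r (X r')" using X[of r'] by (auto simp: P_def)
        then show ?thesis by blast
      qed
      then have "u + e / 4 \<in> S" by (auto simp: S_def)
      then have "u + e / 4 \<le> Sup S" using bdd by (rule cSup_upper)
      then show False using u(2) e by simp
    qed
    then obtain r where r: "r > i" "U r = U r0" "wt (winners n' (X r)) < u + e / 4" by blast
    \<comment> \<open>The pieces that become winners only between \<open>n\<close> and
      \<open>n'\<close>. The hulls of the earlier winners lie in \<open>U r0\<close>, so
      \<open>Y\<close> alone has to cover \<open>C \<inter> D i\<close>.\<close>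
    define Y where "Y = winners n' (X r) - winners n (X r)"
    have sub: "winners n (X r) \<subseteq> winners n' (X r)" by (rule winners_mono[OF aX(1)]) (simp add: n'_def)
    have fw: "finite (winners n' (X r))" by (rule finite_subset[OF winners_subset fX])
    have wY: "wt Y = wt (winners n' (X r)) - wt (winners n (X r))"
      unfolding Y_def wt_def using sub fw by (intro sum_diff)
    have "wt Y \<le> e / 4" using wY r(3) X[of r] by (simp add: P_def)
    have "wt Y \<le> 2" using wY wt_mono[OF fX[of r] winners_subset[of n' "X r"]] aX(2)[of r] wt_nonneg[of "winners n (X r)"] by simp
    have "D i \<subseteq> (\<Union>t\<in>winners n' (X r). outer n' t)"
    proof (rule cover_winners)
      show "dep n' (D i)" using N by (rule dep_mono) (simp add: n'_def)
      show "D i \<subseteq> points" using D(1)[of i] B(1)[of "Suc i"] by (rule order_trans)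
      have "B (Suc i) \<subseteq> B r" using r(1) by (intro monoD[OF B(4)]) simp
      then show "D i \<subseteq> (\<Union>t\<in>X r. body t)" using D(1)[of i] aX(3)[of r] by blast
    qed (rule aX)+
    moreover have "outer n' t \<subseteq> U r0" if "t \<in> winners n (X r)" for t
      using that outer_antimono[of n n' t] r(2) by (auto simp: U_def n'_def)
    ultimately have "C \<inter> D i \<subseteq> (\<Union>t\<in>Y. outer n' t)" unfolding C_def Y_def by blast
    moreover have "cov k (2 * wt Y) (\<Union>t\<in>Y. outer n' t)"
      using aX(1) \<open>wt Y \<le> 2\<close> by (intro outer_cov[of k "X r"]) (simp_all add: Y_def Diff_subset)
    moreover have "2 * wt Y \<le> e" using \<open>wt Y \<le> e / 4\<close> e by simp
    ultimately show ?thesis using cov_mono by blast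
  qed
  moreover have "C \<subseteq> points" "dep n C" "ind m C"
    using dep_Diff[OF U(2)] ind_Diff[OF U(3)] by (auto simp: C_def)
  ultimately show ?thesis by blast
qed

text \<open>Apply \<open>dichotomy\<close> below each of the finitely many atoms of level
  \<open>m\<close>, sharing \<open>e\<close> among them. The set \<open>b\<close> is large below
  every such atom but nearly invisible to \<open>a i\<close> for large \<open>i\<close>, so removing
  it makes \<open>a i\<close> thin between \<open>m\<close> and \<open>n\<close> at little
  cost.\<close>

lemma junk_at_level:
  fixes a :: "nat \<Rightarrow> (nat \<Rightarrow> nat) set"
  assumes a: "\<And>i. a i \<subseteq> points" "\<And>i. \<exists>n. dep n (a i)" "disjoint_family a" and e: "e > 0"
  shows "\<exists>b n (i0::nat). m < n \<and> dep n b \<and> (\<forall>x\<in>points. \<not> cov k 1 {y \<in> points. graft m x y \<in> b}) \<and>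
    (\<forall>i\<ge>i0. cov k e (a i \<inter> b))"
proof -
  define R where "R = trunc m ` points"
  have finR: "finite R" unfolding R_def by (rule finite_trunc)
  define d where "d = e / (card R + 1)"
  have d: "d > 0" using e by (simp add: d_def)
  obtain N where N: "\<And>i. dep (N i) (a i)" using a(2) by metis
  define Q where "Q x C n i0 \<longleftrightarrow> C \<subseteq> points \<and> dep n C \<and> ind m C \<and> \<not> cov k 1 C \<and>
      (\<forall>i\<ge>i0. cov k d (C \<inter> {y \<in> points. graft m x y \<in> a i}))" for x C n and i0 :: nat
  have "\<exists>C n i0. Q x C n i0" if x: "x \<in> points" for x
    unfolding Q_def
  proof (rule dichotomy[where B = "\<lambda>r. {y \<in> points. graft m x y \<in> (\<Union>i<r. a i)}"])
    have dep: "dep n {y \<in> points. graft m x y \<in> A}" if "dep n A" for n A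
      unfolding dep_def
    proof (intro ballI impI)
      fix y z assume y: "y \<in> {y \<in> points. graft m x y \<in> A}" and z: "z \<in> points" "\<forall>i<n. z i = y i"
      have "\<forall>i<n. graft m x z i = graft m x y i" using z(2) by (simp add: graft_def)
      then have "graft m x z \<in> A"
        using \<open>dep n A\<close> y graft_in_points[OF x z(1)] unfolding dep_def by blast
      then show "z \<in> {y \<in> points. graft m x y \<in> A}" using z by simp
    qed
    show "\<exists>n. dep n {y \<in> points. graft m x y \<in> a i}" for i using dep N by blast
    show "\<exists>n. dep n {y \<in> points. graft m x y \<in> (\<Union>i<r. a i)}" for r
    proof (intro exI dep dep_UN)
      fix i assume "i \<in> {..<r}"
      then have "N i \<le> (\<Sum>i<r. N i)" by (intro member_le_sum) auto
      with N show "dep (\<Sum>i<r. N i) (a i)" by (rule dep_mono)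
    qed
    show "ind m {y \<in> points. graft m x y \<in> (\<Union>i<r. a i)}" for r
      unfolding ind_def
    proof (intro ballI impI)
      fix y z assume y: "y \<in> {y \<in> points. graft m x y \<in> (\<Union>i<r. a i)}" and z: "z \<in> points" "\<forall>i\<ge>m. z i = y i"
      have "graft m x z = graft m x y" using z(2) by (auto simp: graft_def)
      then show "z \<in> {y \<in> points. graft m x y \<in> (\<Union>i<r. a i)}" using y z(1) by simp
    qed
    show "mono (\<lambda>r. {y \<in> points. graft m x y \<in> (\<Union>i<r. a i)})"
      by (rule monoI) (use less_le_trans in blast)
    show "{y \<in> points. graft m x y \<in> a i} \<inter> {y \<in> points. graft m x y \<in> (\<Union>i<i. a i)} = {}" for i
    proof (rule equals0I)
      fix y assume "y \<in> {y \<in> points. graft m x y \<in> a i} \<inter> {y \<in> points. graft m x y \<in> (\<Union>i<i. a i)}"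
      then obtain j where "j < i" "graft m x y \<in> a i \<inter> a j" by auto
      then show False using disjoint_family_onD[OF a(3), of i j] by simp
    qed
  qed (use d in auto)
  then obtain C n i0 where "\<And>x. x \<in> points \<Longrightarrow> Q x (C x) (n x) (i0 x)" by metis
  then have C: "C x \<subseteq> points" "dep (n x) (C x)" "ind m (C x)" "\<not> cov k 1 (C x)"
      "\<And>i. i \<ge> i0 x \<Longrightarrow> cov k d (C x \<inter> {y \<in> points. graft m x y \<in> a i})" if "x \<in> points" for x
    using that unfolding Q_def by blast+
  \<comment> \<open>Below each atom of level \<open>m\<close>, the set found for its representative
    \<open>trunc m z\<close> is used.\<close>
  define b where "b = {z \<in> points. z \<in> C (trunc m z)}"
  define M where "M = Suc m + (\<Sum>x\<in>R. n x)"
  have Rp: "x \<in> points" if "x \<in> R" for x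
    using that by (auto simp: R_def intro!: graft_in_points zero_in_points)
  have tR: "trunc m z \<in> R" if "z \<in> points" for z using that by (auto simp: R_def)
  have "dep M b"
    unfolding dep_def
  proof (intro ballI impI)
    fix y z assume y: "y \<in> b" and z: "z \<in> points" "\<forall>i<M. z i = y i"
    have yp: "y \<in> points" using y by (simp add: b_def)
    have t: "trunc m z = trunc m y" using z(2) by (intro trunc_cong) (simp add: M_def)
    have "n (trunc m y) \<le> (\<Sum>x\<in>R. n x)" using finR tR[OF yp] by (intro member_le_sum) auto
    then have "dep M (C (trunc m y))" 
      using C(2)[OF Rp[OF tR[OF yp]]] by (intro dep_mono[of "n (trunc m y)" _ M]) (simp_all add: M_def)
    moreover have "y \<in> C (trunc m y)" using y by (simp add: b_def)
    ultimately have "z \<in> C (trunc m y)" using z unfolding dep_def by blast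
    then show "z \<in> b" using z(1) t by (simp add: b_def)
  qed
  moreover have "\<not> cov k 1 {y \<in> points. graft m x y \<in> b}" if x: "x \<in> points" for x
  proof
    assume c: "cov k 1 {y \<in> points. graft m x y \<in> b}"
    note xp = Rp[OF tR[OF x]]
    have "C (trunc m x) \<subseteq> {y \<in> points. graft m x y \<in> b}"
    proof
      fix y assume y: "y \<in> C (trunc m x)"
      have yp: "y \<in> points" using y C(1)[OF xp] by blast
      have sp: "graft m x y \<in> points" using x yp by (rule graft_in_points)
      have "graft m x y \<in> C (trunc m x)" using C(3)[OF xp] y sp unfolding ind_def by simp
      moreover have "trunc m (graft m x y) = trunc m x" by (rule trunc_cong) simp
      ultimately show "y \<in> {y \<in> points. graft m x y \<in> b}" using yp sp by (simp add: b_def)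
    qed
    then show False using C(4)[OF xp] cov_mono[OF c] by blast
  qed
  moreover have "cov k e (a i \<inter> b)" if i: "i \<ge> (\<Sum>x\<in>R. i0 x)" for i
  proof -
    have "cov k d (C x \<inter> {y \<in> points. graft m x y \<in> a i})" if x: "x \<in> R" for x
    proof -
      have "i0 x \<le> (\<Sum>x\<in>R. i0 x)" using finR x by (intro member_le_sum) auto
      then show ?thesis using C(5)[OF Rp[OF x]] i by simp
    qed
    then have "cov k (\<Sum>x\<in>R. d) (\<Union>x\<in>R. C x \<inter> {y \<in> points. graft m x y \<in> a i})"
      using finR by (intro cov_UN)
    moreover have "(\<Sum>x\<in>R. d) \<le> e" using e by (simp add: d_def field_simps)
    moreover have "a i \<inter> b \<subseteq> (\<Union>x\<in>R. C x \<inter> {y \<in> points. graft m x y \<in> a i})"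
    proof
      fix z assume z: "z \<in> a i \<inter> b"
      then have "z \<in> points" by (simp add: b_def)
      moreover have "graft m (trunc m z) z = z" by (auto simp: graft_def)
      ultimately show "z \<in> (\<Union>x\<in>R. C x \<inter> {y \<in> points. graft m x y \<in> a i})"
        using z tR[of z] by (intro UN_I[of "trunc m z"]) (auto simp: b_def)
    qed
    ultimately show ?thesis using cov_mono by blast
  qed
  moreover have "m < M" by (simp add: M_def)
  ultimately show ?thesis by blast
qed

text \<open>Iterate \<open>junk_at_level\<close>. What remains of \<open>a i\<close> after removing
  finitely many junk sets is a piece of class \<open>k\<close> and of weight
  \<open>(1/2) ^ k\<close>; the removed parts cost at most \<open>e\<close>. Junk is measured by
  classes from \<open>Suc k\<close> on, which are the ones that test a piece of class
  \<open>k\<close>.\<close>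

lemma eventually_cov:
  fixes a :: "nat \<Rightarrow> (nat \<Rightarrow> nat) set"
  assumes a: "\<And>i. a i \<subseteq> points" "\<And>i. \<exists>n. dep n (a i)" "disjoint_family a" and e: "e > 0"
  shows "\<exists>i0. \<forall>i\<ge>i0. cov k ((1/2) ^ k + e) (a i)"
proof -
  define d where "d j = e * (1/2) ^ Suc j" for j :: nat
  have d: "d j > 0" for j using e by (simp add: d_def)
  define Q where "Q m j b n i0 \<longleftrightarrow> m < n \<and> dep n b \<and>
      (\<forall>x\<in>points. \<not> cov (Suc k) 1 {y \<in> points. graft m x y \<in> b}) \<and>
      (\<forall>i\<ge>i0. cov (Suc k) (d j) (a i \<inter> b))" for m j b n and i0 :: nat
  have "\<exists>b n i0. Q m j b n i0" for m j
    using junk_at_level[OF a d] unfolding Q_def by blast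
  then obtain b n i0 where Q: "\<And>m j. Q m j (b m j) (n m j) (i0 m j)" by metis
  then have less: "m < n m j" and dep: "dep (n m j) (b m j)"
    and ncov: "x \<in> points \<Longrightarrow> \<not> cov (Suc k) 1 {y \<in> points. graft m x y \<in> b m j}"
    and covd: "i \<ge> i0 m j \<Longrightarrow> cov (Suc k) (d j) (a i \<inter> b m j)" for m j x i
    unfolding Q_def by blast+
  define l where "l = rec_nat 0 (\<lambda>j m. n m j)"
  have l: "l (Suc j) = n (l j) j" for j by (simp add: l_def)
  have sm: "strict_mono l" using less by (simp add: strict_mono_Suc_iff l)
  \<comment> \<open>Finitely many of these levels have full norm, so only finitely many thresholds
    \<open>i0 (l j) j\<close> must be passed.\<close>
  have "infinite (range l)" using strict_mono_imp_inj_on[OF sm] range_inj_infinite by blast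
  then obtain A where A: "A \<subseteq> range l" "finite A" "full_norm k \<le> h A" using norm_unbounded by blast
  obtain S where S: "finite S" "A = l ` S" using finite_subset_image[OF A(2,1)] by blast
  obtain J where J: "S \<subseteq> {..<J}" using finite_nat_iff_bounded S(1) by blast
  define L where "L = l ` {..<J}"
  have full: "full_norm k \<le> h L" using A(3) norm_mono[of L A] S J by (force simp: L_def)
  define i1 where "i1 = (\<Sum>j<J. i0 (l j) j)"
  have "cov k ((1/2) ^ k + e) (a i)" if i: "i \<ge> i1" for i
  proof -
    define t where "t = Piece (a i - (\<Union>j<J. b (l j) j)) L k"
    have wk: "wgt t = (1/2) ^ k" using full by (simp add: wgt_def t_def weight_full)
    have "good t"
    proof (rule goodI)
      have "weight k L \<le> 1" using full by (simp add: weight_full power_le_one)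
      then show "\<exists>i\<in>lev t. cls t < i" using guard[of k L] by (simp add: t_def L_def)
      fix m' n' x X assume m': "m' \<in> lev t" and n': "n' \<in> lev t" and mn: "m' < n'" and x: "x \<in> points"
        and X: "adm (Suc (cls t)) X" "wt X < 1"
      obtain p q where pq: "p < J" "q < J" "m' = l p" "n' = l q" using m' n' by (auto simp: t_def L_def)
      have "p < q" using mn pq strict_mono_less[OF sm] by simp
      then have lpq: "l (Suc p) \<le> n'" using pq strict_mono_less_eq[OF sm] by simp
      \<comment> \<open>Since \<open>X\<close> cannot cover the trace of the junk, some
        \<open>y\<close> in the trace avoids \<open>X\<close>. The atom of level
        \<open>l (Suc p) \<le> n'\<close> around \<open>graft m' x y\<close> lies in the removed set
        and so misses the body.\<close>
      have "\<not> cov (Suc k) 1 {y \<in> points. graft m' x y \<in> b m' p}" using x by (rule ncov)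
      then have "\<not> {y \<in> points. graft m' x y \<in> b m' p} \<subseteq> (\<Union>s\<in>X. body s)"
        using X unfolding cov_def by (auto simp: t_def less_imp_le)
      then obtain y where y: "y \<in> points" "graft m' x y \<in> b m' p" "\<And>s. s \<in> X \<Longrightarrow> y \<notin> body s" by blast
      have "kills n' (graft m' x y) (body t)"
        unfolding kills_def
      proof (rule ballI, rule ccontr)
        fix z assume z: "z \<in> body t" and "\<not> (\<exists>i<n'. z i \<noteq> graft m' x y i)"
        then have "\<forall>i<l (Suc p). z i = graft m' x y i" using lpq by auto
        moreover have "dep (l (Suc p)) (b m' p)" using dep pq by (simp add: l)
        moreover have "z \<in> points" using z a(1) by (auto simp: t_def)
        ultimately have "z \<in> b m' p" using y(2) unfolding dep_def by blast
        then show False using z pq by (auto simp: t_def)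
      qed
      then show "\<exists>y\<in>points. kills n' (graft m' x y) (body t) \<and> (\<forall>s\<in>X. y \<notin> body s)" using y by blast
    qed (simp add: t_def L_def)
    then have "cov k ((1/2) ^ k) (body t)"
      unfolding cov_def using wk by (intro exI[of _ "{t}"]) (simp add: adm_def wt_def t_def)
    moreover have "cov k (\<Sum>j<J. d j) (\<Union>j<J. a i \<inter> b (l j) j)"
    proof (rule cov_UN)
      fix j assume j: "j \<in> {..<J}"
      then have "i0 (l j) j \<le> i1" unfolding i1_def by (intro member_le_sum) auto
      then have "cov (Suc k) (d j) (a i \<inter> b (l j) j)" using i by (intro covd) simp
      then show "cov k (d j) (a i \<inter> b (l j) j)" by (rule cov_antimono_class) simp
    qed simp
    ultimately have "cov k ((1/2) ^ k + (\<Sum>j<J. d j)) (body t \<union> (\<Union>j<J. a i \<inter> b (l j) j))" by (rule cov_Un)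
    moreover have "(\<Sum>j<J. d j) \<le> e"
    proof -
      have "(\<Sum>j<J. d j) = e * (1 - (1/2) ^ J)"
        by (induction J) (simp_all add: d_def field_simps)
      then show ?thesis using e by simp
    qed
    moreover have "a i \<subseteq> body t \<union> (\<Union>j<J. a i \<inter> b (l j) j)" by (auto simp: t_def)
    ultimately show ?thesis using cov_mono[of k _ _ "(1/2) ^ k + e" "a i"] by simp
  qed
  then show ?thesis by blast
qed

end

section \<open>The submeasure\<close>

lemma topspace_T_top: "topspace T_top = points"
  by (auto simp: T_top_def points_def PiE_UNIV_domain)

lemma openin_T_top_dep:
  assumes "A \<subseteq> points" "dep n A"
  shows "openin T_top A"
  unfolding T_top_def openin_product_topology_alt
proof
  fix x assume x: "x \<in> A"
  then have xp: "x i < 2 ^ i" for i using assms(1) by (auto simp: points_def)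
  define U where "U i = (if i < n then {x i} else {..<2 ^ i})" for i :: nat
  have "{i \<in> UNIV. U i \<noteq> topspace (discrete_topology {..<2 ^ i})} \<subseteq> {..<n}" by (auto simp: U_def)
  then have "finite {i \<in> UNIV. U i \<noteq> topspace (discrete_topology {..<2 ^ i})}"
    by (rule finite_subset) simp
  moreover have "\<forall>i\<in>UNIV. openin (discrete_topology {..<2 ^ i}) (U i)" using xp by (auto simp: U_def)
  moreover have "x \<in> PiE UNIV U" using xp by (auto simp: U_def)
  moreover have "PiE UNIV U \<subseteq> A"
  proof
    fix z assume "z \<in> PiE UNIV U"
    then have zU: "z i \<in> U i" for i by auto
    have "z i < 2 ^ i" for i using zU[of i] xp[of i] by (cases "i < n") (auto simp: U_def)
    moreover have "z i = x i" if "i < n" for i using zU[of i] that by (simp add: U_def)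
    ultimately show "z \<in> A" using assms(2) x unfolding dep_def by (simp add: points_def)
  qed
  ultimately show "\<exists>U. finite {i \<in> UNIV. U i \<noteq> topspace (discrete_topology {..<2 ^ i})} \<and>
      (\<forall>i\<in>UNIV. openin (discrete_topology {..<2 ^ i}) (U i)) \<and> x \<in> PiE UNIV U \<and> PiE UNIV U \<subseteq> A" by blast
qed

lemma openin_T_top_nbhd:
  assumes "openin T_top A" "x \<in> A"
  shows "\<exists>n. \<forall>z\<in>points. (\<forall>i<n. z i = x i) \<longrightarrow> z \<in> A"
proof -
  obtain U where U: "finite {i. U i \<noteq> {..<2 ^ i}}" "x \<in> PiE UNIV U" "PiE UNIV U \<subseteq> A"
    using assms unfolding T_top_def openin_product_topology_alt by auto
  obtain n where n: "{i. U i \<noteq> {..<2 ^ i}} \<subseteq> {..<n}" using finite_nat_iff_bounded U(1) by blast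
  have "z \<in> A" if "z \<in> points" "\<forall>i<n. z i = x i" for z
  proof -
    have "z i \<in> U i" for i
    proof (cases "i < n")
      case True
      then show ?thesis using that(2) U(2) by auto
    next
      case False
      then have "U i = {..<2 ^ i}" using n by auto
      then show ?thesis using that(1) by (simp add: points_def)
    qed
    then have "z \<in> PiE UNIV U" by auto
    then show ?thesis using U(3) by blast
  qed
  then show ?thesis by blast
qed

lemma compact_space_T_top: "compact_space T_top"
  by (simp add: T_top_def compact_space_product_topology compact_space_discrete_topology)

text \<open>By compactness, finitely many cylinders, each inside \<open>A\<close> or inside its
  complement, cover the space.\<close>

lemma clopens_iff: "A \<in> clopens \<longleftrightarrow> A \<subseteq> points \<and> (\<exists>n. dep n A)"
proof
  assume "A \<subseteq> points \<and> (\<exists>n. dep n A)"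
  then obtain n where n: "A \<subseteq> points" "dep n A" by blast
  then have "openin T_top A" "openin T_top (points - A)"
    using openin_T_top_dep dep_Diff by blast+
  then show "A \<in> clopens" using n(1) by (simp add: clopens_def closedin_def topspace_T_top)
next
  assume "A \<in> clopens"
  then have o: "openin T_top A" "openin T_top (points - A)" and sub: "A \<subseteq> points"
    by (simp_all add: clopens_def closedin_def topspace_T_top)
  define cyl where "cyl n x = {z \<in> points. \<forall>i<n. z i = x i}" for n :: nat and x :: "nat \<Rightarrow> nat"
  have "\<exists>n. cyl n x \<subseteq> A \<or> cyl n x \<subseteq> points - A" if "x \<in> points" for x
  proof (cases "x \<in> A")
    case True
    then obtain n where "\<forall>z\<in>points. (\<forall>i<n. z i = x i) \<longrightarrow> z \<in> A"
      using openin_T_top_nbhd[OF o(1)] by blast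
    then show ?thesis by (intro exI[of _ n]) (auto simp: cyl_def)
  next
    case False
    then obtain n where "\<forall>z\<in>points. (\<forall>i<n. z i = x i) \<longrightarrow> z \<in> points - A"
      using openin_T_top_nbhd[OF o(2)] \<open>x \<in> points\<close> by blast
    then show ?thesis by (intro exI[of _ n]) (auto simp: cyl_def)
  qed
  then obtain n where n: "\<And>x. x \<in> points \<Longrightarrow> cyl (n x) x \<subseteq> A \<or> cyl (n x) x \<subseteq> points - A" by metis
  define \<U> where "\<U> = (\<lambda>x. cyl (n x) x) ` points"
  have "cyl m x \<subseteq> points" "dep m (cyl m x)" for m x by (auto simp: cyl_def dep_def)
  then have "openin T_top (cyl m x)" for m x by (rule openin_T_top_dep)
  then have "openin T_top U" if "U \<in> \<U>" for U
    using that by (auto simp: \<U>_def)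
  moreover have "topspace T_top \<subseteq> \<Union>\<U>" by (auto simp: topspace_T_top \<U>_def cyl_def)
  ultimately have "\<exists>\<F>. finite \<F> \<and> \<F> \<subseteq> \<U> \<and> topspace T_top \<subseteq> \<Union>\<F>"
    using compact_space_T_top[unfolded compact_space_alt, rule_format, of \<U>] by simp
  then obtain \<F> where \<F>: "finite \<F>" "\<F> \<subseteq> \<U>" "points \<subseteq> \<Union>\<F>"
    unfolding topspace_T_top by blast
  then obtain S where "S \<subseteq> points" "finite S" "\<F> = (\<lambda>x. cyl (n x) x) ` S"
    using finite_subset_image[OF \<F>(1) \<F>(2)[unfolded \<U>_def]] by blast
  with \<F>(3) have S: "finite S" "S \<subseteq> points" "points \<subseteq> (\<Union>x\<in>S. cyl (n x) x)" by simp_all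
  \<comment> \<open>The sum is just a common upper bound of the finitely many
    \<open>n x\<close>.\<close>
  have "dep (\<Sum>x\<in>S. n x) A"
    unfolding dep_def
  proof (intro ballI impI)
    fix y z assume y: "y \<in> A" and z: "z \<in> points" and eq: "\<forall>i<(\<Sum>x\<in>S. n x). z i = y i"
    obtain x where x: "x \<in> S" "y \<in> cyl (n x) x" using S(3) y sub by blast
    have "n x \<le> (\<Sum>x\<in>S. n x)" using S(1) x(1) by (intro member_le_sum) auto
    then have "z i = y i" if "i < n x" for i using eq that by simp
    then have "z \<in> cyl (n x) x" using x(2) z by (simp add: cyl_def)
    moreover have "cyl (n x) x \<subseteq> A" using n[of x] x S(2) y by blast
    ultimately show "z \<in> A" by blast
  qed
  then show "A \<subseteq> points \<and> (\<exists>n. dep n A)" using sub by blast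
qed

lemma countable_clopens: "countable clopens"
proof -
  have eq: "clopens = (\<Union>n. {U. U \<subseteq> points \<and> dep n U})" by (auto simp: clopens_iff)
  show ?thesis unfolding eq by (rule countable_UN) (simp_all only: countable_finite finite_dep countableI_type)
qed

context norm_family
begin

section \<open>The infimum over covers as a submeasure\<close>

definition nu :: "(nat \<Rightarrow> nat) set \<Rightarrow> ennreal" where
  "nu A = (INF X \<in> {X. adm 0 X \<and> A \<subseteq> (\<Union>t\<in>X. body t)}. ennreal (wt X))"

lemma nu_le: "cov 0 v A \<Longrightarrow> nu A \<le> ennreal v"
  unfolding nu_def cov_def by (auto intro!: INF_lower2 ennreal_leI)

lemma less_nu:
  assumes "nu A < ennreal v"
  shows "cov 0 v A"
proof -
  obtain X where X: "adm 0 X" "A \<subseteq> (\<Union>t\<in>X. body t)" "ennreal (wt X) < ennreal v"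
    using assms unfolding nu_def INF_less_iff by auto
  then have "wt X < v" using wt_nonneg[of X] by (simp add: ennreal_less_iff)
  then show ?thesis using X unfolding cov_def by (auto intro: less_imp_le)
qed

lemma nu_empty: "nu {} = 0"
  using nu_le[OF cov_empty[of 0 0]] by simp

lemma nu_mono: "A \<subseteq> B \<Longrightarrow> nu A \<le> nu B"
  unfolding nu_def by (rule INF_superset_mono) auto

lemma nu_Un: "nu (A \<union> B) \<le> nu A + nu B"
proof (rule ennreal_le_epsilon)
  fix e :: real assume fin: "nu A + nu B < top" and e: "0 < e"
  obtain a b where ab: "nu A = ennreal a" "0 \<le> a" "nu B = ennreal b" "0 \<le> b"
    using fin by (cases "nu A"; cases "nu B") auto
  have "cov 0 (a + e/2) A" "cov 0 (b + e/2) B"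
    using ab e by (intro less_nu; simp add: ennreal_less_iff)+
  then have "cov 0 ((a + e/2) + (b + e/2)) (A \<union> B)" by (rule cov_Un)
  then have "nu (A \<union> B) \<le> ennreal (a + b + e)" using nu_le by (simp add: algebra_simps)
  then show "nu (A \<union> B) \<le> nu A + nu B + ennreal e" using ab e by (simp add: ennreal_plus)
qed

lemma submeasure_nu: "submeasure clopens nu"
  unfolding submeasure_def using nu_empty nu_mono nu_Un by blast

lemma exhaustive_nu: "exhaustive clopens nu"
  unfolding exhaustive_def
proof (intro allI impI)
  fix a :: "nat \<Rightarrow> (nat \<Rightarrow> nat) set"
  assume a: "range a \<subseteq> clopens \<and> disjoint_family a"
  then have a': "a i \<subseteq> points" "\<exists>n. dep n (a i)" for i
    using clopens_iff[of "a i"] by auto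
  show "(\<lambda>n. nu (a n)) \<longlonglongrightarrow> 0"
  proof (rule order_tendstoI)
    fix v :: ennreal assume "0 < v"
    then obtain w where w: "0 < w" "w < v" using dense by blast
    then obtain r where r: "w = ennreal r" "0 < r" by (cases w) auto
    obtain k where k: "(1/2::real) ^ k < r / 2" using r(2) real_arch_pow_inv[of "r/2" "1/2"] by auto
    have "disjoint_family a" "0 < r / 2" using a r(2) by auto
    then obtain i0 where i0: "\<And>i. i \<ge> i0 \<Longrightarrow> cov k ((1/2) ^ k + r / 2) (a i)"
      using eventually_cov[of a, OF a'] by blast
    have "nu (a i) < v" if "i \<ge> i0" for i
    proof -
      have "cov 0 ((1/2) ^ k + r / 2) (a i)" using i0[OF that] by (rule cov_antimono_class) simp
      then have "nu (a i) \<le> ennreal ((1/2) ^ k + r / 2)" by (rule nu_le)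
      also have "\<dots> \<le> w" unfolding r(1) using k by (intro ennreal_leI) simp
      finally show ?thesis using w(2) by simp
    qed
    then show "\<forall>\<^sub>F n in sequentially. nu (a n) < v" unfolding eventually_sequentially by blast
  qed simp
qed

lemma nu_cylinder:
  assumes "J \<in> F" "x \<in> points"
  shows "1 \<le> nu {z \<in> points. \<forall>i\<in>J. z i = x i}"
proof (rule ccontr)
  assume "\<not> 1 \<le> nu {z \<in> points. \<forall>i\<in>J. z i = x i}"
  then have "nu {z \<in> points. \<forall>i\<in>J. z i = x i} < 1" by simp
  then obtain w where w: "nu {z \<in> points. \<forall>i\<in>J. z i = x i} < w" "w < 1" using dense by blast
  then obtain r where r: "w = ennreal r" "0 \<le> r" by (cases w) auto
  have "cov 0 r {z \<in> points. \<forall>i\<in>J. z i = x i}" using w(1) r(1) less_nu by simp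
  moreover have "r < 1" using w(2) r by simp
  ultimately show False using cylinder_not_cov[OF assms] by blast
qed

end

section \<open>Norms from well-founded families\<close>

definition unsep :: "nat set \<Rightarrow> nat set \<Rightarrow> bool" where
  "unsep J K \<longleftrightarrow> (\<forall>j\<in>J. K \<subseteq> {..j} \<or> K \<subseteq> {j<..})"

text \<open>A game-like recursion: a set of norm \<open>Suc n\<close> must answer every cut by a
  member of \<open>F\<close> with an unseparated subset of norm \<open>n\<close>. The cardinality
  clause gives \<open>norm_le_card\<close> and bounds the maximum in \<open>fnorm\<close>.\<close>

primrec big :: "nat set set \<Rightarrow> nat \<Rightarrow> nat set \<Rightarrow> bool" where
  "big F 0 A \<longleftrightarrow> True"
| "big F (Suc n) A \<longleftrightarrow> n < card A \<and> (\<forall>J\<in>F. \<exists>K\<subseteq>A. unsep J K \<and> big F n K)"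

definition fnorm :: "nat set set \<Rightarrow> nat set \<Rightarrow> nat" where
  "fnorm F A = Max {n. big F n A}"

definition desc :: "('a \<times> 'a) set \<Rightarrow> (nat \<Rightarrow> 'a) \<Rightarrow> nat set set" where
  "desc R f = {J. finite J \<and> (\<forall>m\<in>J. \<forall>n\<in>J. m < n \<longrightarrow> (f n, f m) \<in> R)}"

lemma big_mono: "big F n A \<Longrightarrow> finite B \<Longrightarrow> A \<subseteq> B \<Longrightarrow> big F n B"
proof (cases n)
  case (Suc n')
  assume *: "big F n A" "finite B" "A \<subseteq> B"
  have "card A \<le> card B" using *(2,3) by (rule card_mono)
  moreover have "\<exists>K\<subseteq>B. unsep J K \<and> big F n' K" if J: "J \<in> F" for J
  proof -
    obtain K where "K \<subseteq> A" "unsep J K" "big F n' K" using * J by (auto simp: Suc)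
    then show ?thesis using *(3) by (intro exI[of _ K]) simp
  qed
  ultimately show ?thesis using * by (simp add: Suc)
qed simp

lemma big_le_card: "big F n A \<Longrightarrow> n \<le> card A"
  by (cases n) auto

lemma finite_big: "finite {n. big F n A}"
  using big_le_card[of F _ A] by (intro finite_subset[OF _ finite_atMost[of "card A"]]) auto

lemma big_fnorm: "big F (fnorm F A) A"
proof -
  have "0 \<in> {n. big F n A}" by simp
  then have "fnorm F A \<in> {n. big F n A}" unfolding fnorm_def using finite_big by (intro Max_in) blast+
  then show ?thesis by simp
qed

lemma fnorm_ge: "big F n A \<Longrightarrow> n \<le> fnorm F A"
  unfolding fnorm_def using finite_big by (intro Max_ge) auto

text \<open>Start with a big \<open>A0\<close> inside \<open>{..q}\<close>. If \<open>J\<close>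
  separates \<open>A0\<close>, its least element \<open>n\<close> is below \<open>q\<close>, and the
  rest of \<open>J\<close> has \<open>f\<close>-values below \<open>f n\<close>. A set beyond
  \<open>n\<close> that answers all such rests therefore answers \<open>J\<close> too; the union of
  \<open>A0\<close> and these finitely many sets works.\<close>

lemma big_step:
  assumes IH: "\<And>M. infinite M \<Longrightarrow> \<exists>A\<subseteq>M. finite A \<and> big F N A"
    and Q_def: "\<And>V. Q V \<longleftrightarrow> (\<forall>M. infinite M \<longrightarrow> (\<exists>A\<subseteq>M. finite A \<and>
      (\<forall>J\<in>F. f ` J \<subseteq> V \<longrightarrow> (\<exists>K\<subseteq>A. unsep J K \<and> big F N K))))"
    and F: "F = desc R f" and V: "\<And>v. v \<in> V \<Longrightarrow> Q {u. (u, v) \<in> R}"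
  shows "Q V"
  unfolding Q_def
proof (intro allI impI)
  fix M :: "nat set" assume M: "infinite M"
  obtain A0 where A0: "A0 \<subseteq> M" "finite A0" "big F N A0" using IH[OF M] by blast
  obtain q where q: "A0 \<subseteq> {..q}" using finite_nat_iff_bounded_le A0(2) by blast
  have "\<exists>A. A \<subseteq> M \<inter> {n<..} \<and> finite A \<and> (\<forall>J\<in>F. f ` J \<subseteq> {u. (u, f n) \<in> R} \<longrightarrow> (\<exists>K\<subseteq>A. unsep J K \<and> big F N K))"
    if "f n \<in> V" for n
  proof -
    have "infinite (M \<inter> {n<..})"
    proof
      assume "finite (M \<inter> {n<..})"
      then have "finite ((M \<inter> {n<..}) \<union> {..n})" by simp
      moreover have "M \<subseteq> (M \<inter> {n<..}) \<union> {..n}" by auto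
      ultimately show False using M finite_subset by blast
    qed
    then show ?thesis using V[OF that] unfolding Q_def by blast
  qed
  then obtain A where A: "\<And>n. f n \<in> V \<Longrightarrow> A n \<subseteq> M \<inter> {n<..}" "\<And>n. f n \<in> V \<Longrightarrow> finite (A n)"
    "\<And>n J. f n \<in> V \<Longrightarrow> J \<in> F \<Longrightarrow> f ` J \<subseteq> {u. (u, f n) \<in> R} \<Longrightarrow> \<exists>K\<subseteq>A n. unsep J K \<and> big F N K"
    by metis
  define A' where "A' = A0 \<union> (\<Union>n\<in>{n\<in>{..q}. f n \<in> V}. A n)"
  have "\<exists>K\<subseteq>A'. unsep J K \<and> big F N K" if J: "J \<in> F" "f ` J \<subseteq> V" for J
  proof (cases "unsep J A0")
    case True
    then show ?thesis using A0(3) by (intro exI[of _ A0]) (simp add: A'_def)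
  next
    case False
    then obtain j where j: "j \<in> J" "\<not> A0 \<subseteq> {..j}" by (auto simp: unsep_def)
    then obtain x where "x \<in> A0" "j < x" by (meson atMost_iff not_le subsetI)
    then have "j < q" using q by auto
    have fin: "finite J" using J(1) by (simp add: F desc_def)
    define n where "n = Min J"
    have n: "n \<in> J" "n \<le> j" "\<And>i. i \<in> J \<Longrightarrow> n \<le> i"
      using Min_in[OF fin] Min_le[OF fin] j(1) unfolding n_def by blast+
    have fn: "f n \<in> V" using n(1) J(2) by blast
    have "J - {n} \<in> F" using J(1) by (auto simp: F desc_def)
    moreover have "f ` (J - {n}) \<subseteq> {u. (u, f n) \<in> R}"
    proof (rule image_subsetI)
      fix i assume i: "i \<in> J - {n}"
      then have "n < i" using n(3)[of i] by simp
      then show "f i \<in> {u. (u, f n) \<in> R}" using J(1) i n(1) by (simp add: F desc_def)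
    qed
    ultimately obtain K where K: "K \<subseteq> A n" "unsep (J - {n}) K" "big F N K" using A(3)[OF fn] by blast
    have "K \<subseteq> {n<..}" using K(1) A(1)[OF fn] by blast
    then have "unsep J K" using K(2) by (auto simp: unsep_def)
    moreover have "A n \<subseteq> A'" using \<open>j < q\<close> n(2) fn by (auto simp: A'_def)
    then have "K \<subseteq> A'" using K(1) by (rule order_trans[rotated])
    ultimately show ?thesis using K(3) by blast
  qed
  moreover have "A' \<subseteq> M"
  proof -
    have "A n \<subseteq> M" if "f n \<in> V" for n using A(1)[OF that] by blast
    then show ?thesis using A0(1) by (auto simp: A'_def)
  qed
  moreover have "finite A'" using A0(2) A(2) by (auto simp: A'_def)
  ultimately show "\<exists>A\<subseteq>M. finite A \<and> (\<forall>J\<in>F. f ` J \<subseteq> V \<longrightarrow> (\<exists>K\<subseteq>A. unsep J K \<and> big F N K))" by blast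
qed

text \<open>Induction on \<open>N\<close>; in each step a well-founded induction along
  \<open>R\<close> with \<open>big_step\<close> extends the claim from \<open>J\<close> with values
  below a point to all \<open>J\<close>.\<close>

lemma big_in_infinite:
  assumes "wf R" "infinite M"
  shows "\<exists>A\<subseteq>M. finite A \<and> big (desc R f) N A"
  using assms(2)
proof (induction N arbitrary: M)
  case 0
  then show ?case by (intro exI[of _ "{}"]) simp
next
  case (Suc N)
  define Q where "Q V \<longleftrightarrow> (\<forall>M. infinite M \<longrightarrow> (\<exists>A\<subseteq>M. finite A \<and>
    (\<forall>J\<in>desc R f. f ` J \<subseteq> V \<longrightarrow> (\<exists>K\<subseteq>A. unsep J K \<and> big (desc R f) N K))))" for V
  have step: "Q V" if "\<And>v. v \<in> V \<Longrightarrow> Q {u. (u, v) \<in> R}" for V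
    by (rule big_step[where F = "desc R f" and f = f and R = R and Q = Q and N = N])
      (fact Suc.IH, fact Q_def, rule refl, fact that)
  have Qv: "Q {u. (u, v) \<in> R}" for v
    using assms(1)
  proof (induction v rule: wf_induct_rule)
    case (less v)
    show ?case
    proof (rule step)
      fix y assume "y \<in> {u. (u, v) \<in> R}"
      then show "Q {u. (u, y) \<in> R}" using less by simp
    qed
  qed
  have "Q UNIV" by (rule step) (rule Qv)
  then have "\<exists>A\<subseteq>M. finite A \<and> (\<forall>J\<in>desc R f. \<exists>K\<subseteq>A. unsep J K \<and> big (desc R f) N K)"
    using Suc.prems unfolding Q_def by simp
  then obtain A where A: "A \<subseteq> M" "finite A" "\<forall>J\<in>desc R f. \<exists>K\<subseteq>A. unsep J K \<and> big (desc R f) N K"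
    by blast
  \<comment> \<open>The set \<open>B\<close> provides the cardinality clause of
    \<open>big\<close>.\<close>
  obtain B where B: "finite B" "card B = Suc N" "B \<subseteq> M"
    using infinite_arbitrarily_large[OF Suc.prems] by blast
  have "card B \<le> card (A \<union> B)" using A(2) B(1) by (intro card_mono) auto
  moreover have "\<exists>K\<subseteq>A \<union> B. unsep J K \<and> big (desc R f) N K" if J: "J \<in> desc R f" for J
  proof -
    obtain K where "K \<subseteq> A" "unsep J K" "big (desc R f) N K" using A(3) J by blast
    then show ?thesis by (intro exI[of _ K]) auto
  qed
  ultimately have "big (desc R f) (Suc N) (A \<union> B)" using B(2) by simp
  then show ?case using A(1,2) B(1,3) by (intro exI[of _ "A \<union> B"]) simp
qed

text \<open>\<open>norm_cut\<close> is read off from the recursion for \<open>big\<close>.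
  Well-foundedness of \<open>R\<close> enters through \<open>big_in_infinite\<close>, which gives
  unboundedness.\<close>

lemma norm_family_desc:
  assumes "wf R"
  shows "norm_family (fnorm (desc R f)) (desc R f)"
proof
  show "fnorm (desc R f) A \<le> fnorm (desc R f) B" if "finite B" "A \<subseteq> B" for A B
    by (rule fnorm_ge, rule big_mono[OF big_fnorm that])
  show "fnorm (desc R f) A \<le> card A" for A
    using big_fnorm by (rule big_le_card)
  show "\<exists>K\<subseteq>A. (\<forall>j\<in>J. K \<subseteq> {..j} \<or> K \<subseteq> {j<..}) \<and> fnorm (desc R f) A \<le> Suc (fnorm (desc R f) K)"
    if J: "J \<in> desc R f" for J A
  proof (cases "fnorm (desc R f) A")
    case 0
    then show ?thesis by (intro exI[of _ "{}"]) simp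
  next
    case (Suc n)
    then have "big (desc R f) (Suc n) A" using big_fnorm[of "desc R f" A] by (simp only: Suc)
    then obtain K where K: "K \<subseteq> A" "unsep J K" "big (desc R f) n K" using J by auto
    then have "Suc n \<le> Suc (fnorm (desc R f) K)" using fnorm_ge by simp
    then show ?thesis using K(1,2) Suc unfolding unsep_def by (intro exI[of _ K]) simp
  qed
  show "\<exists>A\<subseteq>M. finite A \<and> N \<le> fnorm (desc R f) A" if "infinite M" for M N
  proof -
    obtain A where "A \<subseteq> M" "finite A" "big (desc R f) N A"
      using big_in_infinite[OF assms \<open>infinite M\<close>] by blast
    then show ?thesis using fnorm_ge[of "desc R f" N A] by blast
  qed
qed (auto simp: desc_def)

section \<open>Ranks\<close>

definition seg :: "nat set rel \<Rightarrow> nat set \<Rightarrow> ordinal" where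
  "seg r x = abs_ordinal (Restr r (underS r x))"

lemma less_abs_ordinal:
  assumes r: "Well_order r" and b: "b < abs_ordinal r"
  shows "\<exists>x\<in>Field r. b = seg r x"
proof -
  obtain s where s: "Well_order s" "b = abs_ordinal s" by (rule ordinal_cases)
  have "(s, r) \<in> ordLess" using b s r by (simp add: abs_ordinal_simps)
  then obtain x where x: "x \<in> Field r" "(s, Restr r (underS r x)) \<in> ordIso"
    using ordLess_iff_ordIso_Restr r s(1) by blast
  have "Well_order (Restr r (underS r x))" using r by (rule Well_order_Restr)
  then have "b = seg r x" using x(2) s abs_ordinal_simps(3)[OF s(1)] by (simp add: seg_def)
  then show ?thesis using x(1) by blast
qed

lemma seg_less_abs_ordinal:
  assumes r: "Well_order r" and x: "x \<in> Field r"
  shows "seg r x < abs_ordinal r"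
proof -
  have "(Restr r (underS r x), r) \<in> ordLess" using r x by (intro underS_Restr_ordLess) auto
  then show ?thesis using abs_ordinal_simps(2)[OF Well_order_Restr[OF r] r] by (simp add: seg_def)
qed

lemma seg_strict_mono:
  assumes r: "Well_order r" and xy: "(x, y) \<in> r" "x \<noteq> y"
  shows "seg r x < seg r y"
proof -
  interpret W: wo_rel r using r by (simp add: wo_rel_def)
  have "underS r x \<subset> underS r y"
  proof
    show "underS r x \<subseteq> underS r y"
      using xy W.TRANS W.ANTISYM unfolding underS_def by (auto dest: transD antisymD)
    have "x \<in> underS r y" "x \<notin> underS r x" using xy by (auto simp: underS_def)
    then show "underS r x \<noteq> underS r y" by blast
  qed
  then have "(Restr r (underS r x), Restr r (underS r y)) \<in> ordLess"
    using ofilter_subset_ordLess[OF r W.underS_ofilter W.underS_ofilter] by blast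
  then show ?thesis
    using abs_ordinal_simps(2)[OF Well_order_Restr[OF r] Well_order_Restr[OF r]] by (simp add: seg_def)
qed

lemma well_order_cases:
  assumes "Well_order r" "x \<in> Field r" "y \<in> Field r" "x \<noteq> y"
  shows "(x, y) \<in> r \<or> (y, x) \<in> r"
  using assms unfolding well_order_on_def linear_order_on_def total_on_def by blast

lemma less_seg:
  assumes r: "Well_order r" and x: "x \<in> Field r" and b: "b < seg r x"
  shows "\<exists>y. (y, x) \<in> r - Id \<and> b = seg r y"
proof -
  have "b < abs_ordinal r" using b seg_less_abs_ordinal[OF r x] by (rule less_trans)
  then obtain y where y: "y \<in> Field r" "b = seg r y" using less_abs_ordinal[OF r] by blast
  have "y \<noteq> x" using b y by auto
  moreover have "(x, y) \<notin> r"
  proof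
    assume "(x, y) \<in> r"
    then have "seg r x < b" using seg_strict_mono[OF r] \<open>y \<noteq> x\<close> y(2) by blast
    then show False using b by simp
  qed
  ultimately show ?thesis using well_order_cases[OF r x y(1)] y(2) by blast
qed

section \<open>Countable ordinals\<close>

text \<open>The map \<open>seg r\<close> embeds the field of a representing well-order into the
  ordinals below \<open>a\<close>.\<close>

lemma countable_ordinalI:
  assumes "countable {..<a}"
  shows "countable_ordinal a"
proof -
  obtain r where r: "Well_order r" "a = abs_ordinal r" by (rule ordinal_cases)
  have "inj_on (seg r) (Field r)"
  proof (rule inj_onI, rule ccontr)
    fix x y assume *: "x \<in> Field r" "y \<in> Field r" "seg r x = seg r y" "x \<noteq> y"
    then have "(x, y) \<in> r \<or> (y, x) \<in> r" using well_order_cases[OF r(1)] by blast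
    then show False using seg_strict_mono[OF r(1), of x y] seg_strict_mono[OF r(1), of y x] * by auto
  qed
  moreover have "seg r ` Field r \<subseteq> {..<a}" using seg_less_abs_ordinal[OF r(1)] r(2) by auto
  then have "countable (seg r ` Field r)" using assms countable_subset by blast
  ultimately have "countable (Field r)" by (rule countable_image_inj_on[rotated])
  moreover have "(r, r) \<in> ordIso" using r(1) by (rule ordIso_reflexive)
  ultimately show ?thesis by (simp add: r(2) countable_ordinal.abs_eq)
qed

lemma countable_Sup_ordinal:
  fixes S :: "ordinal set"
  assumes "countable S" "\<And>a. a \<in> S \<Longrightarrow> countable {..<a}"
  shows "countable {..<Sup S}"
proof (cases "S = {}")
  case True
  then show ?thesis by (simp add: lessThan_def not_less_bot)
next
  case False
  then have "{..<Sup S} \<subseteq> (\<Union>a\<in>S. {..<a})" using less_cSupD by auto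
  moreover have "countable (\<Union>a\<in>S. {..<a})" using assms by (rule countable_UN)
  ultimately show ?thesis by (rule countable_subset)
qed

lemma less_succ_ordinal: "a < succ_ordinal a"
  unfolding succ_ordinal_def by (rule LeastI_ex[OF gt_ex])

lemma succ_ordinal_le: "a < b \<Longrightarrow> succ_ordinal a \<le> b"
  unfolding succ_ordinal_def by (rule Least_le)

lemma countable_succ_ordinal:
  assumes "countable {..<a}"
  shows "countable {..<succ_ordinal a}"
proof (rule countable_subset)
  show "{..<succ_ordinal a} \<subseteq> insert a {..<a}"
    using not_less_Least[of _ "\<lambda>b. a < b"] unfolding succ_ordinal_def by force
qed (use assms in simp)

text \<open>Members of \<open>S\<close> inject into \<open>nat set\<close> as singletons of their
  indices. The upper-bound property of \<open>Sup\<close> on ordinals requires such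
  boundedness.\<close>

lemma bdd_above_countable_ordinal:
  fixes S :: "ordinal set"
  assumes "countable S"
  shows "bdd_above S"
proof -
  have "inj_on (\<lambda>x. {to_nat_on S x}) S"
    using inj_on_to_nat_on[OF assms] by (auto simp: inj_on_def)
  then have "S \<lesssim> (UNIV :: nat set set)" by (auto simp: lepoll_def)
  then obtain b where "\<forall>a\<in>S. a < b" using bdd_above_ordinal by blast
  then show ?thesis by (auto intro!: bdd_aboveI[of _ b] less_imp_le)
qed

section \<open>Exhaustivity ranks over a countable algebra\<close>

lemma countable_disjoint_families:
  assumes "countable B"
  shows "countable {G \<in> disjoint_families B \<nu> \<epsilon>. F \<subset> G}"
proof (rule countable_subset)
  show "{G \<in> disjoint_families B \<nu> \<epsilon>. F \<subset> G} \<subseteq> {G. finite G \<and> G \<subseteq> B}"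
    by (auto simp: disjoint_families_def)
  show "countable {G. finite G \<and> G \<subseteq> B}" using assms by (rule countable_Collect_finite_subset)
qed

lemma rank_at_less:
  assumes "countable B" "exhaustive B \<nu>" "\<epsilon> > 0"
    and "G \<in> disjoint_families B \<nu> \<epsilon>" "F \<subset> G"
  shows "rank_at B \<nu> \<epsilon> G < rank_at B \<nu> \<epsilon> F"
proof -
  have "succ_ordinal (rank_at B \<nu> \<epsilon> G) \<le> rank_at B \<nu> \<epsilon> F"
    unfolding rank_at_eq[OF assms(2,3), of F]
    using assms(4,5) countable_disjoint_families[OF assms(1)]
    by (intro cSUP_upper bdd_above_countable_ordinal countable_image) auto
  then show ?thesis using less_succ_ordinal by (rule less_le_trans[rotated])
qed

lemma countable_rank_at:
  assumes "countable B" "exhaustive B \<nu>" "\<epsilon> > 0"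
  shows "countable {..<rank_at B \<nu> \<epsilon> F}"
  using wf_extension_rel[OF assms(2,3)]
proof (induction F rule: wf_induct_rule)
  case (less F)
  show ?case
    unfolding rank_at_eq[OF assms(2,3), of F]
  proof (rule countable_Sup_ordinal)
    fix a assume "a \<in> (\<lambda>G. succ_ordinal (rank_at B \<nu> \<epsilon> G)) ` {G \<in> disjoint_families B \<nu> \<epsilon>. F \<subset> G}"
    then obtain G where G: "G \<in> disjoint_families B \<nu> \<epsilon>" "F \<subset> G" "a = succ_ordinal (rank_at B \<nu> \<epsilon> G)"
      by blast
    then have "(G, F) \<in> extension_rel B \<nu> \<epsilon>" by (simp add: extension_rel_def)
    then show "countable {..<a}" unfolding G(3) by (intro countable_succ_ordinal less)
  qed (intro countable_image countable_disjoint_families assms(1))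
qed

text \<open>A family for \<epsilon>' is also one for \<epsilon>; the ranks are compared by
  well-founded induction.\<close>

lemma rank_at_antimono:
  assumes B: "countable B" "exhaustive B \<nu>" and e: "0 < \<epsilon>" "\<epsilon> \<le> \<epsilon>'"
  shows "rank_at B \<nu> \<epsilon>' F \<le> rank_at B \<nu> \<epsilon> F"
proof -
  have e': "\<epsilon>' > 0" using e by simp
  show ?thesis
    using wf_extension_rel[OF B(2) e']
  proof (induction F rule: wf_induct_rule)
    case (less F)
    let ?S = "{G \<in> disjoint_families B \<nu> \<epsilon>'. F \<subset> G}"
    show ?case
    proof (cases "?S = {}")
      case True
      then show ?thesis unfolding rank_at_eq[OF B(2) e', of F] by (simp only: image_empty Sup_ordinal_empty bot_least)
    next
      case False
      have "succ_ordinal (rank_at B \<nu> \<epsilon>' G) \<le> rank_at B \<nu> \<epsilon> F" if G: "G \<in> ?S" for G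
      proof (rule succ_ordinal_le)
        have "(G, F) \<in> extension_rel B \<nu> \<epsilon>'" using G by (simp add: extension_rel_def)
        then have "rank_at B \<nu> \<epsilon>' G \<le> rank_at B \<nu> \<epsilon> G" by (rule less)
        also have "G \<in> disjoint_families B \<nu> \<epsilon>"
          using G ennreal_leI[OF e(2)] unfolding disjoint_families_def by (auto intro: order_trans)
        then have "rank_at B \<nu> \<epsilon> G < rank_at B \<nu> \<epsilon> F" using G by (intro rank_at_less B e(1)) auto
        finally show "rank_at B \<nu> \<epsilon>' G < rank_at B \<nu> \<epsilon> F" .
      qed
      with False show ?thesis unfolding rank_at_eq[OF B(2) e', of F] by (intro cSUP_least)
    qed
  qed
qed

lemma ex_inverse_Suc_le:
  assumes "(\<epsilon>::real) > 0"
  shows "\<exists>n. inverse (real (Suc n)) \<le> \<epsilon>"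
  using reals_Archimedean[OF assms] less_imp_le by blast

text \<open>The supremum runs over uncountably many \<epsilon>, but by antitonicity the values at
  \<open>inverse (real (Suc n))\<close> are cofinal, and countably many ordinals are
  bounded.\<close>

lemma rank_at_le_exhaustivity_rank:
  assumes B: "countable B" "exhaustive B \<nu>" and e: "\<epsilon> > 0"
  shows "rank_at B \<nu> \<epsilon> {} \<le> exhaustivity_rank B \<nu>"
  unfolding exhaustivity_rank_def
proof (rule cSUP_upper)
  have "bdd_above (range (\<lambda>n. rank_at B \<nu> (inverse (real (Suc n))) {}))"
    by (intro bdd_above_countable_ordinal) simp
  then obtain b where b: "\<And>n. rank_at B \<nu> (inverse (real (Suc n))) {} \<le> b"
    unfolding bdd_above_def by blast
  have "rank_at B \<nu> \<delta> {} \<le> b" if "\<delta> > 0" for \<delta>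
  proof -
    obtain n where "inverse (real (Suc n)) \<le> \<delta>" using ex_inverse_Suc_le[OF \<open>\<delta> > 0\<close>] by blast
    then have "rank_at B \<nu> \<delta> {} \<le> rank_at B \<nu> (inverse (real (Suc n))) {}"
      by (intro rank_at_antimono B) auto
    then show ?thesis using b by (rule order_trans)
  qed
  then show "bdd_above ((\<lambda>\<epsilon>. rank_at B \<nu> \<epsilon> {}) ` {0<..})" by (intro bdd_aboveI[of _ b]) auto
qed (use e in simp)

lemma countable_exhaustivity_rank:
  assumes B: "countable B" "exhaustive B \<nu>"
  shows "countable_ordinal (exhaustivity_rank B \<nu>)"
proof (rule countable_ordinalI, rule countable_subset)
  show "{..<exhaustivity_rank B \<nu>} \<subseteq> (\<Union>n. {..<rank_at B \<nu> (inverse (real (Suc n))) {}})"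
  proof
    fix b assume "b \<in> {..<exhaustivity_rank B \<nu>}"
    then have "\<exists>a\<in>(\<lambda>\<epsilon>. rank_at B \<nu> \<epsilon> {}) ` {0<..}. b < a"
      unfolding exhaustivity_rank_def by (intro less_cSupD) auto
    then obtain \<epsilon> :: real where \<epsilon>: "\<epsilon> > 0" "b < rank_at B \<nu> \<epsilon> {}" by auto
    obtain n where "inverse (real (Suc n)) \<le> \<epsilon>" using ex_inverse_Suc_le[OF \<epsilon>(1)] by blast
    then have "rank_at B \<nu> \<epsilon> {} \<le> rank_at B \<nu> (inverse (real (Suc n))) {}"
      by (intro rank_at_antimono B) auto
    then have "b < rank_at B \<nu> (inverse (real (Suc n))) {}" using \<epsilon>(2) by simp
    then show "b \<in> (\<Union>n. {..<rank_at B \<nu> (inverse (real (Suc n))) {}})" by blast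
  qed
  have "countable {..<rank_at B \<nu> (inverse (real (Suc n))) {}}" for n
    by (intro countable_rank_at B) simp
  then show "countable (\<Union>n. {..<rank_at B \<nu> (inverse (real (Suc n))) {}})" by simp
qed

section \<open>The lower bound for the rank\<close>

text \<open>For \<open>j\<close> in \<open>J\<close> this is a cylinder on the elements of
  \<open>J\<close> up to \<open>j\<close>, so enlarging \<open>J\<close> upwards leaves it
  unchanged. The value 1 is possible only for \<open>j \<ge> 1\<close>, as coordinate 0 is constant;
  hence the condition \<open>J \<subseteq> {1..}\<close> below.\<close>

definition cell :: "nat set \<Rightarrow> nat \<Rightarrow> (nat \<Rightarrow> nat) set" where
  "cell J j = {z \<in> points. (\<forall>i\<in>J. i < j \<longrightarrow> z i = 0) \<and> z j = 1}"

lemma cell_clopen: "cell J j \<in> clopens"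
proof -
  have "dep (Suc j) (cell J j)" unfolding dep_def cell_def by auto
  then show ?thesis by (auto simp: clopens_iff cell_def)
qed

lemma cell_nonempty:
  assumes "1 \<le> j"
  shows "(\<lambda>i. if i = j then 1 else 0) \<in> cell J j"
  using assms one_less_power[of "2::nat" j] by (auto simp: cell_def points_def)

lemma cell_disjoint:
  assumes "i \<in> J" "j \<in> J" "i \<noteq> j"
  shows "cell J i \<inter> cell J j = {}"
  using assms by (auto simp: cell_def dest: nat_neq_iff[THEN iffD1])

text \<open>Each cell is a cylinder over an initial part of \<open>J\<close>, again a member of
  \<open>desc R f\<close>, so the hypothesis on cylinders applies.\<close>

lemma cells_disjoint_family:
  assumes cyl: "\<And>J x. J \<in> desc R f \<Longrightarrow> x \<in> points \<Longrightarrow> 1 \<le> \<nu> {z \<in> points. \<forall>i\<in>J. z i = x i}"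
    and J: "J \<in> desc R f" "J \<subseteq> {1..}"
  shows "cell J ` J \<in> disjoint_families clopens \<nu> 1"
  unfolding disjoint_families_def
proof (intro CollectI conjI ballI)
  show "finite (cell J ` J)" using J(1) by (simp add: desc_def)
  show "cell J ` J \<subseteq> clopens" using cell_clopen by blast
  show "disjoint (cell J ` J)"
    using cell_disjoint[of _ J] unfolding disjoint_def by blast
  fix a assume "a \<in> cell J ` J"
  then obtain j where j: "j \<in> J" "a = cell J j" by blast
  define J' where "J' = {i \<in> J. i \<le> j}"
  define x where "x i = (if i = j then 1 else 0 :: nat)" for i
  have "J' \<in> desc R f" using J(1) by (auto simp: desc_def J'_def)
  moreover have "0 < j" using j(1) J(2) by auto
  then have "x \<in> points" using one_less_power[of "2::nat" j] by (simp add: x_def points_def)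
  ultimately have "1 \<le> \<nu> {z \<in> points. \<forall>i\<in>J'. z i = x i}" by (rule cyl)
  also have "{z \<in> points. \<forall>i\<in>J'. z i = x i} = cell J j"
    using j(1) by (auto simp: cell_def J'_def x_def)
  finally show "ennreal 1 \<le> \<nu> a" by (simp add: j(2))
qed

lemma cells_extend:
  assumes J: "\<And>i. i \<in> J \<Longrightarrow> i < n" and n: "1 \<le> n"
  shows "cell J ` J \<subset> cell (insert n J) ` insert n J"
proof
  have "cell (insert n J) j = cell J j" if "j \<in> J" for j
    using J[OF that] by (auto simp: cell_def)
  then show "cell J ` J \<subseteq> cell (insert n J) ` insert n J" by auto
  have "cell (insert n J) n \<noteq> cell J j" if j: "j \<in> J" for j
  proof
    assume "cell (insert n J) n = cell J j"
    then have "cell (insert n J) n = cell (insert n J) j" using J[OF j] by (auto simp: cell_def)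
    moreover have "cell (insert n J) n \<inter> cell (insert n J) j = {}"
      using J[OF j] j by (intro cell_disjoint) auto
    ultimately show False using cell_nonempty[OF n, of "insert n J"] by blast
  qed
  then show "cell J ` J \<noteq> cell (insert n J) ` insert n J" by blast
qed

text \<open>Well-founded induction on \<open>f m\<close>. A smaller rank would be
  \<open>seg r y\<close> with \<open>y\<close> below \<open>f m\<close>. As \<open>f\<close> takes
  the value \<open>y\<close> at some \<open>n\<close> beyond \<open>m\<close>, adjoining
  \<open>n\<close> to \<open>J\<close> gives a proper extension of rank at least
  \<open>seg r y\<close>, a contradiction.\<close>

lemma seg_le_rank_at:
  assumes r: "Well_order r" and f: "\<And>x m. x \<in> Field r \<Longrightarrow> \<exists>n>m. f n = x"
    and \<nu>: "exhaustive clopens \<nu>"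
      "\<And>J x. J \<in> desc (r - Id) f \<Longrightarrow> x \<in> points \<Longrightarrow> 1 \<le> \<nu> {z \<in> points. \<forall>i\<in>J. z i = x i}"
    and J: "J \<in> desc (r - Id) f" "J \<subseteq> {1..}" "m \<in> J" "\<And>i. i \<in> J \<Longrightarrow> i \<le> m" and m: "f m \<in> Field r"
  shows "seg r (f m) \<le> rank_at clopens \<nu> 1 (cell J ` J)"
proof -
  have wf: "wf (r - Id)" using r by (simp add: well_order_on_def)
  interpret W: wo_rel r using r by (simp add: wo_rel_def)
  have trans: "(a, c) \<in> r - Id" if "(a, b) \<in> r - Id" "(b, c) \<in> r - Id" for a b c
    using that W.TRANS W.ANTISYM by (auto dest: transD antisymD)
  from wf show ?thesis
    using J m
  proof (induction "f m" arbitrary: J m rule: wf_induct_rule)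
    case less
    note prems = less.prems
    show ?case
    proof (rule leI, rule notI)
      assume "rank_at clopens \<nu> 1 (cell J ` J) < seg r (f m)"
      then obtain y where y: "(y, f m) \<in> r - Id" "rank_at clopens \<nu> 1 (cell J ` J) = seg r y"
        using less_seg[OF r prems(5)] by blast
      have "y \<in> Field r" using y(1) by (auto simp: Field_def)
      then obtain n where n: "n > m" "f n = y" using f by blast
      define J' where "J' = insert n J"
      have lt: "i < n" if "i \<in> J" for i using prems(4)[OF that] n(1) by simp
      have "(f n, f i) \<in> r - Id" if "i \<in> J" for i
      proof (cases "i = m")
        case False
        then have "i < m" using prems(4)[OF that] by simp
        then have "(f m, f i) \<in> r - Id" using prems(1,3) that by (simp add: desc_def)
        then show ?thesis using trans y(1) n(2) by blast
      qed (use y n in simp)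
      then have J': "J' \<in> desc (r - Id) f"
        using prems(1) lt unfolding desc_def J'_def by (auto dest: less_asym)
      have sub: "J' \<subseteq> {1..}" using prems(2) n(1) by (auto simp: J'_def)
      have "seg r (f n) \<le> rank_at clopens \<nu> 1 (cell J' ` J')"
      proof (rule less.hyps)
        show "(f n, f m) \<in> r - Id" using y(1) n(2) by simp
        show "f n \<in> Field r" using \<open>y \<in> Field r\<close> n(2) by simp
        show "i \<le> n" if "i \<in> J'" for i using that lt by (auto simp: J'_def less_imp_le)
      qed (use J' sub in \<open>simp_all add: J'_def\<close>)
      moreover have "cell J' ` J' \<in> disjoint_families clopens \<nu> 1"
        using \<nu>(2) J' sub by (rule cells_disjoint_family)
      then have "rank_at clopens \<nu> 1 (cell J' ` J') < rank_at clopens \<nu> 1 (cell J ` J)"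
        using cells_extend[of J n] lt n(1) unfolding J'_def
        by (intro rank_at_less countable_clopens \<nu>(1)) auto
      ultimately show False using y(2) n(2) by simp
    qed
  qed
qed

theorem theorem4p8:
  fixes \<alpha> :: ordinal
  assumes "countable_ordinal \<alpha>"
  shows "\<exists>\<nu>. submeasure clopens \<nu> \<and> exhaustive clopens \<nu> \<and>
           countable_ordinal (exhaustivity_rank clopens \<nu>) \<and>
           \<alpha> \<le> exhaustivity_rank clopens \<nu>"
proof -
  obtain r where r: "Well_order r" "\<alpha> = abs_ordinal r" by (rule ordinal_cases)
  have "(r, r) \<in> ordIso" using r(1) by (rule ordIso_reflexive)
  then have cr: "countable (Field r)" using assms by (simp add: r(2) countable_ordinal.abs_eq)
  have wf: "wf (r - Id)" using r(1) by (simp add: well_order_on_def)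
  \<comment> \<open>Decoding pairs makes every element of the field a value infinitely often. For an
    empty field the values are arbitrary and the next claim is vacuous.\<close>
  define f where "f n = from_nat_into (Field r) (fst (prod_decode n))" for n
  have f: "\<exists>n>m. f n = x" if x: "x \<in> Field r" for x m
  proof (intro exI conjI)
    let ?n = "prod_encode (to_nat_on (Field r) x, Suc m)"
    show "m < ?n" using le_prod_encode_2[of "Suc m" "to_nat_on (Field r) x"] by simp
    show "f ?n = x" using cr x by (simp add: f_def)
  qed
  interpret norm_family "fnorm (desc (r - Id) f)" "desc (r - Id) f"
    using wf by (rule norm_family_desc)
  have "\<alpha> \<le> exhaustivity_rank clopens nu"
  proof (rule leI, rule notI)
    \<comment> \<open>A smaller rank would be \<open>seg r y\<close>. But the family consisting of
      the single cell for \<open>n\<close> already has at least this rank, and the empty family a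
      larger one.\<close>
    assume "exhaustivity_rank clopens nu < \<alpha>"
    then obtain y where y: "y \<in> Field r" "exhaustivity_rank clopens nu = seg r y"
      using less_abs_ordinal[OF r(1)] r(2) by blast
    obtain n where n: "n > 0" "f n = y" using f[OF y(1)] by blast
    have J: "{n} \<in> desc (r - Id) f" "{n} \<subseteq> {1..}" using n(1) by (auto simp: desc_def)
    have "seg r (f n) \<le> rank_at clopens nu 1 (cell {n} ` {n})"
      using y(1) n(2) by (intro seg_le_rank_at r(1) f exhaustive_nu nu_cylinder J) auto
    also have "\<dots> < rank_at clopens nu 1 {}"
      using nu_cylinder J
      by (intro rank_at_less countable_clopens exhaustive_nu cells_disjoint_family) auto
    also have "\<dots> \<le> exhaustivity_rank clopens nu"
      by (intro rank_at_le_exhaustivity_rank countable_clopens exhaustive_nu) simp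
    finally show False using y(2) n(2) by simp
  qed
  then show ?thesis
    using submeasure_nu exhaustive_nu countable_exhaustivity_rank[OF countable_clopens exhaustive_nu] by blast
qed

end
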